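(* Let $G$ be a locally compact, compactly generated group and let $E$ be a Banach space. Let $\pi$ be a strongly continuous representation of $G$ on $E$. Suppose that there is a symmetric probability measure $\mu$ on $G$, given by a continuous compactly supported density with respect to Haar measure and whose support generates $G$, such that the associated Markov operator $A_\pi^\mu v=\int_G \pi_g v\,d\mu(g)$ satisfies $\Vert A_\pi^\mu\Vert\le\lambda<1$ for some $\lambda$. Then, up to isomorphism, $$Z^1(G,\pi)=B^1(G,\pi)\oplus H^1(G,\pi);$$ that is, $B^1(G,\pi)$ is a closed subspace of $Z^1(G,\pi)$, and there is a closed subspace $V\subseteq Z^1(G,\pi)$ such that $Z^1(G,\pi)=B^1(G,\pi)\oplus V$ as a topological direct sum and $V$ is isomorphic, as a normed space, to $H^1(G,\pi)=Z^1(G,\pi)/B^1(G,\pi)$. In particular, this decomposition holds for every strongly continuous isometric representation $\pi$ of a locally compact, compactly generated group $G$, without almost invariant vectors, on a uniformly convex Banach space $E$.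
   Context: A strongly continuous representation $\pi$ of $G$ on $E$ is a homomorphism $g\mapsto\pi_g$ from $G$ to the invertible bounded linear operators on $E$ such that $g\mapsto \pi_g v$ is continuous for every $v\in E$; it is isometric if every $\pi_g$ is an isometry. Integrals are Bochner integrals. $Z^1(G,\pi)$ is the linear space of continuous 1-cocycles, i.e. continuous maps $z:G\to E$, $g\mapsto z_g$, with $z_{gh}=\pi_g z_h+z_g$ for all $g,h\in G$. The codifferential is $d_\pi:E\to Z^1(G,\pi)$, $(d_\pi v)_g=v-\pi_g v$; its range is the space $B^1(G,\pi)$ of coboundaries, and $H^1(G,\pi)=Z^1(G,\pi)/B^1(G,\pi)$ carries the quotient norm when $B^1(G,\pi)$ is closed. $S\subseteq G$ is a fixed compact symmetric generating set; when a measure $\mu$ is given, $\operatorname{supp}\mu\subseteq S$. The space $Z^1(G,\pi)$ is normed by $\Vert z\Vert_S=\sup_{s\in S}\Vert z_s\Vert_E$. The representation $\pi$ does not have almost invariant vectors if there is $\kappa>0$ such that $\sup_{s\in S}\Vert\pi_s v-v\Vert\ge\kappa\Vert v\Vert$ for all $v\in E$. *)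

theory Defs
  imports "HOL-Probability.Probability" "HOL-Library.Function_Algebras"
begin

text \<open>
  Groups are written additively: the class \<^class>\<open>topological_group_add\<close> does not assume
  commutativity, so \<open>g + h\<close>, \<open>- g\<close>, \<open>0\<close> stand for the product, the inverse and the identity of an
  arbitrary topological group.
\<close>

instantiation "fun" :: (type, real_vector) real_vector
begin

definition scaleR_fun :: "real \<Rightarrow> ('a \<Rightarrow> 'b) \<Rightarrow> 'a \<Rightarrow> 'b"
  where "scaleR_fun r f = (\<lambda>x. r *\<^sub>R f x)"

instance
  by standard (simp_all add: scaleR_fun_def fun_eq_iff scaleR_add_right scaleR_add_left)

end

text \<open>
  The norm \<open>N\<close> is only meaningful on \<open>X\<close>, whereas \<^locale>\<open>Metric_space\<close> asks for a distance that is
  nonnegative on the whole type; hence the case distinction.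
\<close>

definition norm_topology :: "('v::real_vector \<Rightarrow> real) \<Rightarrow> 'v set \<Rightarrow> 'v topology"
  where "norm_topology N X =
    Metric_space.mtopology X (\<lambda>x y. if x \<in> X \<and> y \<in> X then N (x - y) else 0)"

definition topological_direct_sum :: "'v::real_vector topology \<Rightarrow> 'v set \<Rightarrow> 'v set \<Rightarrow> bool"
  where "topological_direct_sum T U V \<longleftrightarrow>
    homeomorphic_map (prod_topology (subtopology T U) (subtopology T V)) T (\<lambda>(u, v). u + v)"

text \<open>The quotient \<open>X / B\<close>; its elements are the cosets \<open>x + B\<close>.\<close>

definition quotient_space :: "'v::real_vector set \<Rightarrow> 'v set \<Rightarrow> 'v set set"
  where "quotient_space X B = (\<lambda>x. {x + b | b. b \<in> B}) ` X"

definition quotient_add :: "'v::real_vector set \<Rightarrow> 'v set \<Rightarrow> 'v set"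
  where "quotient_add C D = {c + d | c d. c \<in> C \<and> d \<in> D}"

text \<open>Adding \<open>B\<close> only matters for \<open>r = 0\<close>, where the result has to be the coset \<open>B\<close>.\<close>

definition quotient_scale :: "'v::real_vector set \<Rightarrow> real \<Rightarrow> 'v set \<Rightarrow> 'v set"
  where "quotient_scale B r C = {r *\<^sub>R c + b | c b. c \<in> C \<and> b \<in> B}"

definition quotient_norm :: "('v::real_vector \<Rightarrow> real) \<Rightarrow> 'v set \<Rightarrow> real"
  where "quotient_norm N C = (INF c\<in>C. N c)"

text \<open>Isomorphisms of normed spaces are linear bijections bounded in both directions.\<close>

definition isomorphic_to_quotient ::
    "('v::real_vector \<Rightarrow> real) \<Rightarrow> 'v set \<Rightarrow> 'v set \<Rightarrow> 'v set \<Rightarrow> bool"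
  where "isomorphic_to_quotient N V X B \<longleftrightarrow>
    (\<exists>T. bij_betw T V (quotient_space X B)
      \<and> (\<forall>v\<in>V. \<forall>w\<in>V. T (v + w) = quotient_add (T v) (T w))
      \<and> (\<forall>r. \<forall>v\<in>V. T (r *\<^sub>R v) = quotient_scale B r (T v))
      \<and> (\<exists>c>0. \<exists>C. \<forall>v\<in>V. c * N v \<le> quotient_norm N (T v) \<and> quotient_norm N (T v) \<le> C * N v))"

definition uniformly_convex :: "'e::real_normed_vector itself \<Rightarrow> bool"
  where "uniformly_convex _ \<longleftrightarrow>
    (\<forall>\<epsilon>>0. \<exists>\<delta>>0. \<forall>x y :: 'e. norm x = 1 \<longrightarrow> norm y = 1 \<longrightarrow> \<epsilon> \<le> norm (x - y) \<longrightarrow>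
      norm ((1 / 2) *\<^sub>R (x + y)) \<le> 1 - \<delta>)"

text \<open>
  \<^const>\<open>has_bochner_integral\<close> is restricted to second countable (separable) spaces. The definition
  below is the same one without that restriction.
\<close>

definition has_general_bochner_integral ::
    "'a measure \<Rightarrow> ('a \<Rightarrow> 'e::real_normed_vector) \<Rightarrow> 'e \<Rightarrow> bool"
  where "has_general_bochner_integral M f x \<longleftrightarrow> f \<in> borel_measurable M \<and>
    (\<exists>s. (\<forall>i. Bochner_Integration.simple_bochner_integrable M (s i))
      \<and> (\<lambda>i. \<integral>\<^sup>+y. norm (f y - s i y) \<partial>M) \<longlonglongrightarrow> 0
      \<and> (\<lambda>i. Bochner_Integration.simple_bochner_integral M (s i)) \<longlonglongrightarrow> x)"

lemma has_general_bochner_integral_iff: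
  fixes f :: "'a \<Rightarrow> 'e::{real_normed_vector, second_countable_topology}"
  shows "has_general_bochner_integral M f x \<longleftrightarrow> has_bochner_integral M f x"
  unfolding has_general_bochner_integral_def has_bochner_integral.simps by auto

definition general_bochner_integral :: "'a measure \<Rightarrow> ('a \<Rightarrow> 'e::real_normed_vector) \<Rightarrow> 'e"
  where "general_bochner_integral M f = (THE x. has_general_bochner_integral M f x)"

definition generates_group :: "'g::group_add set \<Rightarrow> bool"
  where "generates_group S \<longleftrightarrow>
    (\<forall>H. S \<subseteq> H \<longrightarrow> 0 \<in> H \<longrightarrow> (\<forall>x\<in>H. \<forall>y\<in>H. x + y \<in> H) \<longrightarrow> (\<forall>x\<in>H. - x \<in> H) \<longrightarrow> H = UNIV)"

definition left_haar_measure :: "'g::topological_group_add measure \<Rightarrow> bool"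
  where "left_haar_measure m \<longleftrightarrow>
    sets m = sets borel
    \<and> emeasure m UNIV \<noteq> 0
    \<and> (\<forall>K. compact K \<longrightarrow> emeasure m K < \<infinity>)
    \<and> (\<forall>A\<in>sets borel. emeasure m A = (INF U\<in>{U. open U \<and> A \<subseteq> U}. emeasure m U))
    \<and> (\<forall>U. open U \<longrightarrow> emeasure m U = (SUP K\<in>{K. compact K \<and> K \<subseteq> U}. emeasure m K))
    \<and> (\<forall>g. \<forall>A\<in>sets borel. emeasure m ((+) g ` A) = emeasure m A)"

definition measure_supp :: "'g::topological_space measure \<Rightarrow> 'g set"
  where "measure_supp \<mu> = {g. \<forall>U. open U \<longrightarrow> g \<in> U \<longrightarrow> emeasure \<mu> U \<noteq> 0}"

definition has_continuous_compact_density :: "'g::topological_group_add measure \<Rightarrow> bool"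
  where "has_continuous_compact_density \<mu> \<longleftrightarrow>
    (\<exists>m \<phi>. left_haar_measure m \<and> continuous_on UNIV \<phi> \<and> (\<forall>g. 0 \<le> \<phi> g)
      \<and> compact (closure {g. \<phi> g \<noteq> 0}) \<and> \<mu> = density m (\<lambda>g. ennreal (\<phi> g)))"

definition symmetric_measure :: "'g::topological_group_add measure \<Rightarrow> bool"
  where "symmetric_measure \<mu> \<longleftrightarrow> (\<forall>A\<in>sets borel. emeasure \<mu> (uminus ` A) = emeasure \<mu> A)"

text \<open>The operators \<open>\<pi> g\<close> are automatically invertible, with inverse \<open>\<pi> (- g)\<close>.\<close>

definition strongly_continuous_rep ::
    "('g::topological_group_add \<Rightarrow> 'e::real_normed_vector \<Rightarrow> 'e) \<Rightarrow> bool"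
  where "strongly_continuous_rep \<pi> \<longleftrightarrow>
    (\<forall>g. bounded_linear (\<pi> g)) \<and> \<pi> 0 = id \<and> (\<forall>g h. \<pi> (g + h) = \<pi> g \<circ> \<pi> h)
    \<and> (\<forall>v. continuous_on UNIV (\<lambda>g. \<pi> g v))"

definition isometric_rep :: "('g \<Rightarrow> 'e::real_normed_vector \<Rightarrow> 'e) \<Rightarrow> bool"
  where "isometric_rep \<pi> \<longleftrightarrow> (\<forall>g v. norm (\<pi> g v) = norm v)"

definition markov_operator ::
    "'g measure \<Rightarrow> ('g \<Rightarrow> 'e::real_normed_vector \<Rightarrow> 'e) \<Rightarrow> 'e \<Rightarrow> 'e"
  where "markov_operator \<mu> \<pi> v = general_bochner_integral \<mu> (\<lambda>g. \<pi> g v)"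

text \<open>Inserting \<open>0\<close> only matters for \<open>S = {}\<close>, where it makes the supremum \<open>0\<close>.\<close>

definition sup_norm_on :: "'g set \<Rightarrow> ('g \<Rightarrow> 'e::real_normed_vector) \<Rightarrow> real"
  where "sup_norm_on S z = Sup (insert 0 ((\<lambda>s. norm (z s)) ` S))"

definition no_almost_invariant_vectors ::
    "'g set \<Rightarrow> ('g \<Rightarrow> 'e::real_normed_vector \<Rightarrow> 'e) \<Rightarrow> bool"
  where "no_almost_invariant_vectors S \<pi> \<longleftrightarrow>
    (\<exists>\<kappa>>0. \<forall>v. \<kappa> * norm v \<le> sup_norm_on S (\<lambda>s. \<pi> s v - v))"

definition cocycles ::
    "('g::topological_group_add \<Rightarrow> 'e::real_normed_vector \<Rightarrow> 'e) \<Rightarrow> ('g \<Rightarrow> 'e) set"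
  where "cocycles \<pi> = {z. continuous_on UNIV z \<and> (\<forall>g h. z (g + h) = \<pi> g (z h) + z g)}"

definition codifferential :: "('g \<Rightarrow> 'e::real_normed_vector \<Rightarrow> 'e) \<Rightarrow> 'e \<Rightarrow> 'g \<Rightarrow> 'e"
  where "codifferential \<pi> v = (\<lambda>g. v - \<pi> g v)"

definition coboundaries :: "('g \<Rightarrow> 'e::real_normed_vector \<Rightarrow> 'e) \<Rightarrow> ('g \<Rightarrow> 'e) set"
  where "coboundaries \<pi> = range (codifferential \<pi>)"

definition cocycle_topology ::
    "'g set \<Rightarrow> ('g::topological_group_add \<Rightarrow> 'e::real_normed_vector \<Rightarrow> 'e) \<Rightarrow> ('g \<Rightarrow> 'e) topology"
  where "cocycle_topology S \<pi> = norm_topology (sup_norm_on S) (cocycles \<pi>)"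

definition cocycles_decompose ::
    "'g set \<Rightarrow> ('g::topological_group_add \<Rightarrow> 'e::real_normed_vector \<Rightarrow> 'e) \<Rightarrow> bool"
  where "cocycles_decompose S \<pi> \<longleftrightarrow>
    subspace (coboundaries \<pi>) \<and> closedin (cocycle_topology S \<pi>) (coboundaries \<pi>) \<and>
    (\<exists>V. subspace V \<and> closedin (cocycle_topology S \<pi>) V
      \<and> topological_direct_sum (cocycle_topology S \<pi>) (coboundaries \<pi>) V
      \<and> isomorphic_to_quotient (sup_norm_on S) V (cocycles \<pi>) (coboundaries \<pi>))"

end

(*
  Let L be a bounded linear map from cocycles to E such that v - L(dv) has norm at most lam |v| for
  some lam < 1. Then Ld is invertible by Banach's fixed point theorem, and d (Ld)^-1 L is a bounded
  projection of the cocycles onto the coboundaries, whose kernel is the complement. If the Markov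
  operator of mu is a contraction, L z is the integral of z with respect to mu; since v - L(dv) is then
  the Markov operator applied to v, nothing else is needed.

  For isometric representations on uniformly convex spaces no Haar measure is used. Instead L is a
  limit, along a filter of neighbourhoods U shrinking to the identity, of the averages over maximal
  U-separated subsets p of a fixed compact set K. Counting separated sets in K and its translates shows
  that p and s + p do not become U-separated from each other when only few points are removed. So if v
  is a unit vector and the unit vector w is moved by s, a fixed proportion of the points (pi g v), g in
  p, is away from w. Taking w in the direction of the limit of the averages of (pi g v), uniform convexity
  bounds the norm of that limit away from 1, uniformly in v.
*)
theory Submission
  imports Defs
begin

section \<open>Bounded projections\<close>

text \<open>In the isometric case the averages must contract all unit vectors by one factor. How
  small U has to be depends on the vector v, because \<open>\<pi>\<close> is only strongly
  continuous; so no fixed finite average is shown to work, and the limit over U is what produces a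
  single operator. The counting constant survives this limit: it is the number of translates of a
  neighbourhood V that cover K, and it is fixed before U is chosen. Counting separated points
  replaces Haar measure in the spirit of Haar's own construction, where sets are compared by numbers
  of small pieces. Finite sets offer no exact invariance, but a definite proportion of p is lost
  whenever P and s + P are kept apart, and uniform convexity turns a definite proportion into a
  definite loss of norm. Neither G nor E has to be second countable. Hence neighbourhoods are
  handled by filters instead of sequences, and integrals by explicit simple functions, since sums of
  Borel maps into E may fail to be Borel.\<close>

locale normed_subspace =
  fixes N :: "'v::real_vector \<Rightarrow> real" and X :: "'v set"
  assumes X_subspace: "subspace X"
    and N_nonneg: "x \<in> X \<Longrightarrow> 0 \<le> N x"
    and N_scale: "x \<in> X \<Longrightarrow> N (r *\<^sub>R x) = \<bar>r\<bar> * N x"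
    and N_triangle: "x \<in> X \<Longrightarrow> y \<in> X \<Longrightarrow> N (x + y) \<le> N x + N y"
    and N_definite: "x \<in> X \<Longrightarrow> N x = 0 \<Longrightarrow> x = 0"
begin

lemma N_minus: "x \<in> X \<Longrightarrow> N (- x) = N x"
  using N_scale[of x "-1"] by simp

lemma N_zero: "N 0 = 0"
  using N_scale[of 0 0] subspace_0[OF X_subspace] by simp

sublocale Metric_space X "\<lambda>x y. if x \<in> X \<and> y \<in> X then N (x - y) else 0"
proof
  fix x y z
  show "0 \<le> (if x \<in> X \<and> y \<in> X then N (x - y) else 0)"
    using N_nonneg subspace_diff[OF X_subspace] by auto
  show "(if x \<in> X \<and> y \<in> X then N (x - y) else 0) = (if y \<in> X \<and> x \<in> X then N (y - x) else 0)"
    using N_minus[of "x - y"] subspace_diff[OF X_subspace] by auto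
  assume "x \<in> X" "y \<in> X"
  then show "((if x \<in> X \<and> y \<in> X then N (x - y) else 0) = 0) = (x = y)"
    using N_definite[of "x - y"] N_zero subspace_diff[OF X_subspace] by auto
  assume "z \<in> X"
  then show "(if x \<in> X \<and> z \<in> X then N (x - z) else 0)
      \<le> (if x \<in> X \<and> y \<in> X then N (x - y) else 0) + (if y \<in> X \<and> z \<in> X then N (y - z) else 0)"
    using N_triangle[of "x - y" "y - z"] subspace_diff[OF X_subspace] \<open>x \<in> X\<close> \<open>y \<in> X\<close> by auto
qed

lemma topspace: "topspace (norm_topology N X) = X"
  by (simp add: norm_topology_def)

lemma openin_iff:
  "openin (norm_topology N X) U \<longleftrightarrow> U \<subseteq> X \<and> (\<forall>x\<in>U. \<exists>e>0. \<forall>y\<in>X. N (y - x) < e \<longrightarrow> y \<in> U)"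
proof -
  have "(mball x e \<subseteq> U) = (\<forall>y\<in>X. N (y - x) < e \<longrightarrow> y \<in> U)" if "x \<in> X" for x e
    using that N_minus[of "y - x" for y] subspace_diff[OF X_subspace] by (auto simp: subset_iff in_mball)
  then show ?thesis
    unfolding norm_topology_def openin_mtopology
    by (intro conj_cong refl) (meson subsetD)
qed

lemma openin_ball:
  assumes "x \<in> X" shows "openin (norm_topology N X) {y \<in> X. N (y - x) < e}"
proof -
  have "{y \<in> X. N (y - x) < e} = mball x e"
    using assms N_minus[of "y - x" for y] subspace_diff[OF X_subspace] by (auto simp: in_mball)
  then show ?thesis
    by (simp add: norm_topology_def)
qed

lemma continuous_map_iff:
  "continuous_map T (norm_topology N X) f \<longleftrightarrow> f \<in> topspace T \<rightarrow> X \<and>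
    (\<forall>x\<in>topspace T. \<forall>e>0. \<exists>U. openin T U \<and> x \<in> U \<and> (\<forall>y\<in>U. N (f y - f x) < e))"
    (is "?L \<longleftrightarrow> ?R")
proof
  assume L: ?L
  then have 1: "f \<in> topspace T \<rightarrow> X"
    by (simp add: continuous_map_def topspace)
  moreover have "\<exists>U. openin T U \<and> x \<in> U \<and> (\<forall>y\<in>U. N (f y - f x) < e)"
    if "x \<in> topspace T" "e > 0" for x e
  proof (intro exI conjI)
    have fx: "f x \<in> X" using 1 that by auto
    show "openin T {y \<in> topspace T. f y \<in> {y \<in> X. N (y - f x) < e}}"
      using L openin_ball[OF fx] openin_continuous_map_preimage by blast
  qed (use that 1 N_zero in auto)
  ultimately show ?R by blast
next
  assume R: ?R
  have "openin T {x \<in> topspace T. f x \<in> U}" if U: "openin (norm_topology N X) U" for U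
  proof (subst openin_subopen, safe)
    fix x assume x: "x \<in> topspace T" "f x \<in> U"
    obtain e where e: "e > 0" "\<forall>y\<in>X. N (y - f x) < e \<longrightarrow> y \<in> U"
      using U x unfolding openin_iff by blast
    obtain W where W: "openin T W" "x \<in> W" "\<forall>y\<in>W. N (f y - f x) < e"
      using R x e by meson
    moreover have "W \<subseteq> topspace T" using W openin_subset by blast
    ultimately show "\<exists>W. openin T W \<and> x \<in> W \<and> W \<subseteq> {x \<in> topspace T. f x \<in> U}"
      using R e by (intro exI[of _ W]) auto
  qed
  then show ?L
    using R by (auto simp: continuous_map_def topspace)
qed

end

text \<open>A bounded idempotent splits \<open>X\<close> into image and kernel; every clause of
  \<open>cocycles_decompose\<close> is read off from this splitting.\<close>

locale bounded_projection = normed_subspace N X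
  for N :: "'v::real_vector \<Rightarrow> real" and X :: "'v set" +
  fixes P :: "'v \<Rightarrow> 'v" and C :: real
  assumes P_mem: "x \<in> X \<Longrightarrow> P x \<in> X"
    and P_add: "x \<in> X \<Longrightarrow> y \<in> X \<Longrightarrow> P (x + y) = P x + P y"
    and P_scale: "x \<in> X \<Longrightarrow> P (r *\<^sub>R x) = r *\<^sub>R P x"
    and P_idem: "x \<in> X \<Longrightarrow> P (P x) = P x"
    and P_bound: "x \<in> X \<Longrightarrow> N (P x) \<le> C * N x"
begin

abbreviation "T \<equiv> norm_topology N X"
abbreviation "im \<equiv> P ` X"
abbreviation "ker \<equiv> {x \<in> X. P x = 0}"

lemma P_diff: "x \<in> X \<Longrightarrow> y \<in> X \<Longrightarrow> P (x - y) = P x - P y"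
  using P_add[of x "- 1 *\<^sub>R y"] P_scale[of y "-1"] subspace_scale[OF X_subspace, of y "-1"] by simp

lemma P_0: "P 0 = 0"
  using P_scale[of 0 0] subspace_0[OF X_subspace] by simp

lemma subspace_ker: "subspace ker"
  using P_0 P_add P_scale X_subspace unfolding subspace_def by auto

lemma im_eq: "im = {x \<in> X. P x = x}"
  using P_mem P_idem by (auto intro: rev_image_eqI)

lemma subspace_im: "subspace im"
  using P_0 P_add P_scale X_subspace unfolding subspace_def im_eq by auto

lemma continuous_lipschitz:
  assumes f: "\<And>x. x \<in> X \<Longrightarrow> f x \<in> X"
    and L: "\<And>x y. x \<in> X \<Longrightarrow> y \<in> X \<Longrightarrow> N (f y - f x) \<le> L * N (y - x)"
  shows "continuous_map T T f"
  unfolding continuous_map_iff topspace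
proof (intro conjI ballI allI impI)
  fix x and e :: real assume "x \<in> X" "e > 0"
  show "\<exists>U. openin T U \<and> x \<in> U \<and> (\<forall>y\<in>U. N (f y - f x) < e)"
  proof (intro exI conjI ballI)
    show "openin T {y \<in> X. N (y - x) < e / (\<bar>L\<bar> + 1)}"
      using openin_ball[OF \<open>x \<in> X\<close>] .
    fix y assume y: "y \<in> {y \<in> X. N (y - x) < e / (\<bar>L\<bar> + 1)}"
    have nn: "0 \<le> N (y - x)" using y \<open>x \<in> X\<close> N_nonneg subspace_diff[OF X_subspace] by auto
    have "N (f y - f x) \<le> L * N (y - x)" using L \<open>x \<in> X\<close> y by auto
    also have "\<dots> \<le> (\<bar>L\<bar> + 1) * N (y - x)" using nn by (intro mult_right_mono) auto
    also have "\<dots> < e" using y by (simp add: pos_less_divide_eq mult.commute)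
    finally show "N (f y - f x) < e" .
  qed (use \<open>x \<in> X\<close> \<open>e > 0\<close> N_zero in auto)
qed (use f in auto)

lemma continuous_P: "continuous_map T T P"
proof (rule continuous_lipschitz[where L = C])
  fix x y assume "x \<in> X" "y \<in> X"
  then show "N (P y - P x) \<le> C * N (y - x)"
    using P_bound[of "y - x"] P_diff[of y x] subspace_diff[OF X_subspace] by simp
qed (rule P_mem)

lemma complement_bound: "x \<in> X \<Longrightarrow> N (x - P x) \<le> (1 + C) * N x"
  using N_triangle[of x "- P x"] N_minus[of "P x"] P_mem P_bound[of x] subspace_neg[OF X_subspace, of "P x"]
  by (simp add: algebra_simps)

lemma continuous_complement: "continuous_map T T (\<lambda>x. x - P x)"
proof (rule continuous_lipschitz[where L = "1 + C"])
  fix x y assume "x \<in> X" "y \<in> X"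
  then show "N (y - P y - (x - P x)) \<le> (1 + C) * N (y - x)"
    using complement_bound[of "y - x"] subspace_diff[OF X_subspace] P_diff by (simp add: algebra_simps)
qed (use P_mem subspace_diff[OF X_subspace] in auto)

lemma closedin_0: "closedin T {0}"
  unfolding norm_topology_def using subspace_0[OF X_subspace] closedin_Hausdorff_singleton[OF Hausdorff_space_mtopology]
  by simp

lemma closedin_ker: "closedin T ker"
  using closedin_continuous_map_preimage[OF continuous_P closedin_0] by (simp add: topspace)

text \<open>The image is the zero set of the complementary projection \<open>x - P x\<close>, which
  is continuous.\<close>

lemma closedin_im: "closedin T im"
proof -
  have "im = {x \<in> topspace T. x - P x \<in> {0}}" unfolding im_eq topspace by auto
  then show ?thesis
    using closedin_continuous_map_preimage[OF continuous_complement closedin_0] by simp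
qed

lemma direct_sum: "topological_direct_sum T im ker"
proof -
  let ?PT = "prod_topology (subtopology T im) (subtopology T ker)"
  have tops: "topspace ?PT = im \<times> ker"
    using P_mem by (auto simp: topspace)
  have "continuous_map ?PT T (\<lambda>(u, v). u + v)"
    unfolding continuous_map_iff tops
  proof (intro conjI ballI allI impI)
    fix x and e :: real assume x: "x \<in> im \<times> ker" and e: "e > 0"
    obtain u v where uv: "x = (u, v)" "u \<in> im" "v \<in> ker" using x by auto
    then have uX: "u \<in> X" and vX: "v \<in> X" using P_mem by auto
    show "\<exists>U. openin ?PT U \<and> x \<in> U \<and>
      (\<forall>y\<in>U. N ((case y of (u, v) \<Rightarrow> u + v) - (case x of (u, v) \<Rightarrow> u + v)) < e)"
    proof (intro exI conjI ballI)
      let ?U = "({y \<in> X. N (y - u) < e/2} \<inter> im) \<times> ({y \<in> X. N (y - v) < e/2} \<inter> ker)"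
      show "openin ?PT ?U"
        using openin_ball[OF uX] openin_ball[OF vX]
        by (intro openin_prod_Times_iff[THEN iffD2] disjI2 conjI openin_subtopology_Int)
      show "x \<in> ?U" using uv uX vX N_zero e by auto
      fix y assume y: "y \<in> ?U"
      obtain a b where ab: "y = (a, b)" by force
      have "N ((a + b) - (u + v)) \<le> N (a - u) + N (b - v)"
        using N_triangle[of "a - u" "b - v"] y ab uX vX subspace_diff[OF X_subspace]
        by (simp add: algebra_simps)
      also have "\<dots> < e" using y ab by auto
      finally show "N ((case y of (u, v) \<Rightarrow> u + v) - (case x of (u, v) \<Rightarrow> u + v)) < e"
        using ab uv by simp
    qed
  qed (use P_mem subspace_add[OF X_subspace] in auto)
  \<comment> \<open>This map inverts addition; its continuity is that of \<open>P\<close>.\<close>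
  moreover have "continuous_map T ?PT (\<lambda>z. (P z, z - P z))"
    unfolding continuous_map_pairwise o_def continuous_map_in_subtopology topspace
    using continuous_P continuous_complement P_mem P_idem P_diff subspace_diff[OF X_subspace] by auto
  ultimately have "homeomorphic_maps ?PT T (\<lambda>(u, v). u + v) (\<lambda>z. (P z, z - P z))"
    using P_add P_idem P_mem unfolding homeomorphic_maps_def tops topspace by (auto simp: image_iff)
  then show ?thesis
    unfolding topological_direct_sum_def homeomorphic_map_maps by blast
qed

text \<open>The value \<open>x - P x\<close> is constant on each coset of the image, so it recovers
  the kernel element from any representative; \<open>complement_bound\<close> then controls the
  inverse isomorphism.\<close>

lemma ker_isomorphic_quotient: "isomorphic_to_quotient N ker X im"
proof -
  define B where "B = im"
  have B: "subspace B" and PB: "x \<in> X \<Longrightarrow> P x \<in> B" and BX: "b \<in> B \<Longrightarrow> b \<in> X \<and> P b = b" for x b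
    using subspace_im im_eq unfolding B_def by auto
  define Q where "Q x = {x + b | b. b \<in> B}" for x
  have Q_iff: "y \<in> Q x \<longleftrightarrow> y - x \<in> B" for x y
    unfolding Q_def by (auto intro: exI[of _ "y - x"])
  have Q_self: "x \<in> Q x" for x
    using subspace_0[OF B] by (simp add: Q_iff)
  have coset: "Q (x + b) = Q x" if "b \<in> B" for x b
  proof (rule set_eqI)
    fix y
    show "y \<in> Q (x + b) \<longleftrightarrow> y \<in> Q x"
      using subspace_add[OF B _ that, of "y - (x + b)"] subspace_diff[OF B _ that, of "y - x"]
      by (auto simp: Q_iff algebra_simps)
  qed
  have "inj_on Q ker"
  proof (rule inj_onI)
    fix v w assume v: "v \<in> ker" and w: "w \<in> ker" and eq: "Q v = Q w"
    have "v - w \<in> B" using Q_self[of v] unfolding eq Q_iff .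
    then have "P (v - w) = v - w" using BX by blast
    then show "v = w" using P_diff[of v w] v w by simp
  qed
  moreover have "Q ` ker = Q ` X"
  proof (intro equalityI subsetI)
    fix q assume "q \<in> Q ` X"
    then obtain x where x: "x \<in> X" "q = Q x" by blast
    have "x - P x \<in> ker" using x P_diff P_mem P_idem subspace_diff[OF X_subspace] by auto
    moreover have "Q x = Q (x - P x)" using coset[of "P x" "x - P x"] PB x by simp
    ultimately show "q \<in> Q ` ker" using x by blast
  qed blast
  ultimately have 1: "bij_betw Q ker (quotient_space X im)"
    unfolding bij_betw_def quotient_space_def B_def[symmetric] Q_def by (rule conjI)
  have 2: "Q (v + w) = quotient_add (Q v) (Q w)" for v w
  proof (intro set_eqI iffI)
    fix y assume "y \<in> Q (v + w)"
    then have "y - w \<in> Q v" by (simp add: Q_iff algebra_simps)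
    moreover have "y = (y - w) + w" by simp
    ultimately show "y \<in> quotient_add (Q v) (Q w)"
      unfolding quotient_add_def using Q_self by blast
  next
    fix y assume "y \<in> quotient_add (Q v) (Q w)"
    then obtain c d where "y = c + d" "c \<in> Q v" "d \<in> Q w" unfolding quotient_add_def by blast
    then show "y \<in> Q (v + w)"
      using subspace_add[OF B, of "c - v" "d - w"] by (simp add: Q_iff algebra_simps)
  qed
  have 3: "Q (r *\<^sub>R v) = quotient_scale im r (Q v)" for r v
  proof (intro set_eqI iffI)
    fix y assume "y \<in> Q (r *\<^sub>R v)"
    then have "y - r *\<^sub>R v \<in> B" by (simp add: Q_iff)
    moreover have "y = r *\<^sub>R v + (y - r *\<^sub>R v)" by simp
    ultimately show "y \<in> quotient_scale im r (Q v)"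
      unfolding quotient_scale_def B_def[symmetric] using Q_self by blast
  next
    fix y assume "y \<in> quotient_scale im r (Q v)"
    then obtain c b where "y = r *\<^sub>R c + b" "c \<in> Q v" "b \<in> B"
      unfolding quotient_scale_def B_def[symmetric] by blast
    then show "y \<in> Q (r *\<^sub>R v)"
      using subspace_add[OF B subspace_scale[OF B, of "c - v" r], of b] by (simp add: Q_iff algebra_simps)
  qed
  \<comment> \<open>\<open>C\<close> may be negative when \<open>X\<close> is trivial;
    \<open>2 + \<bar>C\<bar>\<close> is positive and dominates \<open>1 + C\<close>.\<close>
  have 4: "1 / (2 + \<bar>C\<bar>) * N v \<le> quotient_norm N (Q v) \<and> quotient_norm N (Q v) \<le> 1 * N v"
    if v: "v \<in> ker" for v
  proof
    have QX: "x \<in> X \<and> x - P x = v" if "x \<in> Q v" for x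
    proof -
      have "x - v \<in> X" "P (x - v) = x - v" using BX that unfolding Q_iff by auto
      moreover from this have "x \<in> X" using subspace_add[OF X_subspace, of "x - v" v] v by simp
      ultimately show ?thesis using P_diff[of x v] v by (simp add: algebra_simps)
    qed
    have "bdd_below (N ` Q v)" using QX N_nonneg by (intro bdd_belowI[of _ 0]) blast
    then show "quotient_norm N (Q v) \<le> 1 * N v"
      unfolding quotient_norm_def using Q_self by (intro cINF_lower2) auto
    show "1 / (2 + \<bar>C\<bar>) * N v \<le> quotient_norm N (Q v)"
      unfolding quotient_norm_def
    proof (rule cINF_greatest)
      fix x assume x: "x \<in> Q v"
      then have "N v \<le> (1 + C) * N x" using complement_bound[of x] QX by auto
      also have "\<dots> \<le> (2 + \<bar>C\<bar>) * N x" using N_nonneg QX x by (intro mult_right_mono) auto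
      finally show "1 / (2 + \<bar>C\<bar>) * N v \<le> N x" by (simp add: field_simps add_pos_nonneg)
    qed (use Q_self in blast)
  qed
  have "\<exists>c>0. \<exists>C. \<forall>v\<in>ker. c * N v \<le> quotient_norm N (Q v) \<and> quotient_norm N (Q v) \<le> C * N v"
    using 4 by (intro exI[of _ "1 / (2 + \<bar>C\<bar>)"] conjI exI[of _ 1] ballI) auto
  then show ?thesis
    unfolding isomorphic_to_quotient_def using 1 2 3 by (intro exI[of _ Q]) blast
qed

end

section \<open>Splitting the codifferential\<close>

lemma codifferential_in_cocycles:
  assumes "strongly_continuous_rep \<pi>"
  shows "codifferential \<pi> v \<in> cocycles \<pi>"
proof -
  interpret bounded_linear "\<pi> g" for g
    using assms by (simp add: strongly_continuous_rep_def)
  show ?thesis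
    using assms unfolding strongly_continuous_rep_def cocycles_def codifferential_def
    by (auto intro!: continuous_intros simp: diff)
qed

lemma codifferential_add:
  assumes "strongly_continuous_rep \<pi>"
  shows "codifferential \<pi> (v + w) = codifferential \<pi> v + codifferential \<pi> w"
proof -
  interpret bounded_linear "\<pi> g" for g
    using assms by (simp add: strongly_continuous_rep_def)
  show ?thesis
    by (simp add: fun_eq_iff codifferential_def add)
qed

lemma codifferential_scaleR:
  assumes "strongly_continuous_rep \<pi>"
  shows "codifferential \<pi> (r *\<^sub>R v) = r *\<^sub>R codifferential \<pi> v"
proof -
  interpret bounded_linear "\<pi> g" for g
    using assms by (simp add: strongly_continuous_rep_def)
  show ?thesis
    by (simp add: fun_eq_iff codifferential_def scaleR scaleR_fun_def scaleR_diff_right)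
qed

lemma cocycle_0:
  assumes "strongly_continuous_rep \<pi>" "z \<in> cocycles \<pi>"
  shows "z 0 = 0"
proof -
  have "z (0 + 0) = \<pi> 0 (z 0) + z 0"
    using assms(2) unfolding cocycles_def by blast
  then show ?thesis
    using assms(1) by (simp add: strongly_continuous_rep_def)
qed

lemma cocycle_add:
  assumes "z \<in> cocycles \<pi>"
  shows "z (g + h) = \<pi> g (z h) + z g"
  using assms by (simp add: cocycles_def)

lemma subspace_cocycles:
  assumes "strongly_continuous_rep \<pi>"
  shows "subspace (cocycles \<pi>)"
proof -
  interpret bounded_linear "\<pi> g" for g
    using assms by (simp add: strongly_continuous_rep_def)
  show ?thesis
    unfolding subspace_def cocycles_def
    by (auto intro!: continuous_intros simp: zero add scaleR scaleR_fun_def zero_fun_def plus_fun_def scaleR_add_right)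
qed

lemma norm_le_sup_norm_on:
  fixes z :: "'g::topological_space \<Rightarrow> 'e::real_normed_vector"
  assumes "compact S" "continuous_on UNIV z" "s \<in> S"
  shows "norm (z s) \<le> sup_norm_on S z"
proof -
  have "compact ((\<lambda>s. norm (z s)) ` S)"
    using assms by (intro compact_continuous_image continuous_intros) (auto intro: continuous_on_subset)
  then have "bdd_above (insert 0 ((\<lambda>s. norm (z s)) ` S))"
    by (simp add: bounded_imp_bdd_above compact_imp_bounded)
  then show ?thesis
    unfolding sup_norm_on_def using assms(3) by (intro cSup_upper) auto
qed

lemma sup_norm_on_nonneg:
  fixes z :: "'g::topological_space \<Rightarrow> 'e::real_normed_vector"
  assumes "compact S" "continuous_on UNIV z"
  shows "0 \<le> sup_norm_on S z"
proof (cases "S = {}")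
  case False
  then obtain s where "s \<in> S" by blast
  then show ?thesis
    using norm_le_sup_norm_on[OF assms, of s] by (meson norm_ge_zero order_trans)
qed (simp add: sup_norm_on_def)

lemma sup_norm_on_le:
  assumes "0 \<le> c" "\<And>s. s \<in> S \<Longrightarrow> norm (z s) \<le> c"
  shows "sup_norm_on S z \<le> c"
  unfolding sup_norm_on_def using assms by (intro cSup_least) auto

text \<open>Compactness of \<open>S\<close> makes the supremum finite on continuous functions;
  definiteness comes from the cocycle identity together with generation by \<open>S\<close>.\<close>

lemma normed_subspace_cocycles:
  assumes \<pi>: "strongly_continuous_rep \<pi>" and S: "compact S" "generates_group S"
  shows "normed_subspace (sup_norm_on S) (cocycles \<pi>)"
proof
  have cont: "continuous_on UNIV z" if "z \<in> cocycles \<pi>" for z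
    using that by (simp add: cocycles_def)
  note le = norm_le_sup_norm_on[OF S(1) cont] and nonneg = sup_norm_on_nonneg[OF S(1) cont]
  show sub: "subspace (cocycles \<pi>)"
    by (rule subspace_cocycles[OF \<pi>])
  fix x assume x: "x \<in> cocycles \<pi>"
  show "0 \<le> sup_norm_on S x" by (rule nonneg[OF x])
  have scale_le: "sup_norm_on S (r *\<^sub>R y) \<le> \<bar>r\<bar> * sup_norm_on S y" if "y \<in> cocycles \<pi>" for r y
    using le[OF that] nonneg[OF that] by (intro sup_norm_on_le) (auto simp: scaleR_fun_def mult_left_mono)
  show "sup_norm_on S (r *\<^sub>R x) = \<bar>r\<bar> * sup_norm_on S x" for r
  proof (cases "r = 0")
    case False
    have "sup_norm_on S x \<le> \<bar>1 / r\<bar> * sup_norm_on S (r *\<^sub>R x)"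
      using scale_le[OF subspace_scale[OF sub x], of "1 / r" r] False by simp
    then show ?thesis
      using scale_le[OF x, of r] False by (simp add: field_simps)
  qed (use scale_le[OF x, of 0] nonneg[OF subspace_scale[OF sub x, of 0]] in simp)
  show "sup_norm_on S (x + y) \<le> sup_norm_on S x + sup_norm_on S y" if y: "y \<in> cocycles \<pi>" for y
    using le[OF x] le[OF y] nonneg[OF x] nonneg[OF y]
    by (intro sup_norm_on_le) (auto intro: norm_triangle_le add_mono)
  show "x = 0" if "sup_norm_on S x = 0"
  proof -
    interpret bounded_linear "\<pi> g" for g
      using \<pi> by (simp add: strongly_continuous_rep_def)
    have "x (- g) = 0" if "x g = 0" for g
      using cocycle_add[OF x, of "- g" g] cocycle_0[OF \<pi> x] that by (simp add: zero)
    moreover have "S \<subseteq> {g. x g = 0}" using le[OF x] that by auto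
    \<comment> \<open>The zero set of a cocycle is a subgroup, and here it contains
      \<open>S\<close>.\<close>
    ultimately have "{g. x g = 0} = UNIV"
      using S(2) cocycle_0[OF \<pi> x] unfolding generates_group_def
      by (elim allE[of _ "{g. x g = 0}"]) (auto simp: cocycle_add[OF x] zero)
    then show ?thesis by (auto simp: fun_eq_iff)
  qed
qed

text \<open>The norm of the projection is estimated by three factors:
  \<open>1 + \<bar>M\<bar>\<close> for the codifferential, \<open>1 / (1 - lam)\<close> for the
  inverse of \<open>J\<close>, and \<open>C\<close> for \<open>L\<close>.\<close>

lemma cocycles_decomposeI:
  fixes \<pi> :: "'g::topological_group_add \<Rightarrow> 'e::banach \<Rightarrow> 'e"
  assumes \<pi>: "strongly_continuous_rep \<pi>" and S: "compact S" "generates_group S"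
    and bound: "\<And>s v. s \<in> S \<Longrightarrow> norm (\<pi> s v) \<le> M * norm v"
    and L_add: "\<And>z w. z \<in> cocycles \<pi> \<Longrightarrow> w \<in> cocycles \<pi> \<Longrightarrow> L (z + w) = L z + L w"
    and L_scale: "\<And>r z. z \<in> cocycles \<pi> \<Longrightarrow> L (r *\<^sub>R z) = r *\<^sub>R L z"
    and L_bound: "\<And>z. z \<in> cocycles \<pi> \<Longrightarrow> norm (L z) \<le> C * sup_norm_on S z"
    and contraction: "\<And>v. norm (v - L (codifferential \<pi> v)) \<le> lam * norm v" and "lam < 1"
  shows "cocycles_decompose S \<pi>"
proof -
  interpret normed_subspace "sup_norm_on S" "cocycles \<pi>"
    by (rule normed_subspace_cocycles[OF \<pi> S])
  define d where "d = codifferential \<pi>"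
  have d: "d v \<in> cocycles \<pi>" "d (v + w) = d v + d w" "d (r *\<^sub>R v) = r *\<^sub>R d v" for v w r
    unfolding d_def using codifferential_in_cocycles codifferential_add codifferential_scaleR \<pi> by blast+
  define J where "J v = L (d v)" for v
  have J_lin: "J (v + w) = J v + J w" "J (r *\<^sub>R v) = r *\<^sub>R J v" for v w r
    unfolding J_def d by (simp_all add: L_add L_scale d)
  have J_diff: "J (v - w) = J v - J w" for v w
    using J_lin(1)[of v "-1 *\<^sub>R w"] J_lin(2)[of "-1" w] by simp
  have J_lower: "norm v \<le> norm (J v) / (1 - lam)" for v
  proof -
    have "norm v \<le> norm (v - J v) + norm (J v)"
      using norm_triangle_ineq[of "v - J v" "J v"] by simp
    also have "\<dots> \<le> lam * norm v + norm (J v)"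
      using contraction by (simp add: J_def d_def)
    finally show ?thesis using \<open>lam < 1\<close> by (simp add: field_simps)
  qed
  have "inj J"
  proof (rule injI)
    fix v w assume "J v = J w"
    then show "v = w" using J_lower[of "v - w"] by (simp add: J_diff)
  qed
  have "\<exists>v. J v = y" for y
  proof -
    \<comment> \<open>A fixed point of this map solves \<open>J v = y\<close>. The contraction
      constant is cut off at \<open>0\<close>, since \<open>lam\<close> may be negative when the
      space is trivial.\<close>
    have "\<exists>!v. y + (v - J v) = v"
    proof (rule banach_fix_type[of "max lam 0"], safe)
      fix v w
      have "norm ((v - w) - J (v - w)) \<le> max lam 0 * norm (v - w)"
        using contraction[of "v - w"] unfolding J_def d_def
        by (rule order_trans) (simp add: mult_right_mono)
      then show "dist (y + (v - J v)) (y + (w - J w)) \<le> max lam 0 * dist v w"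
        by (simp add: dist_norm J_diff algebra_simps)
    qed (use \<open>lam < 1\<close> in auto)
    then obtain v where "y + (v - J v) = v" by blast
    then show ?thesis by (intro exI[of _ v]) (simp add: algebra_simps)
  qed
  then have "surj J" unfolding surj_def by metis
  define T where "T = inv J"
  have JT: "J (T y) = y" and TJ: "T (J v) = v" for y v
    unfolding T_def using \<open>inj J\<close> \<open>surj J\<close> by (simp_all add: surj_f_inv_f)
  have T_lin: "T (v + w) = T v + T w" "T (r *\<^sub>R v) = r *\<^sub>R T v" for v w r
    using TJ[of "T v + T w"] TJ[of "r *\<^sub>R T v"] by (simp_all add: J_lin JT)
  have d_bound: "sup_norm_on S (d v) \<le> (1 + \<bar>M\<bar>) * norm v" for v
  proof (rule sup_norm_on_le)
    fix s assume "s \<in> S"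
    have "norm (d v s) \<le> norm v + norm (\<pi> s v)"
      by (simp add: d_def codifferential_def norm_triangle_ineq4)
    also have "norm (\<pi> s v) \<le> \<bar>M\<bar> * norm v"
      using bound[OF \<open>s \<in> S\<close>, of v] by (rule order_trans) (simp add: mult_right_mono)
    finally show "norm (d v s) \<le> (1 + \<bar>M\<bar>) * norm v" by (simp add: algebra_simps)
  qed simp
  interpret bounded_projection "sup_norm_on S" "cocycles \<pi>" "\<lambda>z. d (T (L z))" "(1 + \<bar>M\<bar>) * (C / (1 - lam))"
  proof
    fix x assume x: "x \<in> cocycles \<pi>"
    show "d (T (L x)) \<in> cocycles \<pi>" by (rule d)
    show "d (T (L (x + y))) = d (T (L x)) + d (T (L y))" if "y \<in> cocycles \<pi>" for y
      using that x by (simp add: L_add T_lin d)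
    show "d (T (L (r *\<^sub>R x))) = r *\<^sub>R d (T (L x))" for r
      using x by (simp add: L_scale T_lin d)
    show "d (T (L (d (T (L x))))) = d (T (L x))"
      unfolding J_def[symmetric] TJ ..
    have "norm (T (L x)) \<le> norm (L x) / (1 - lam)"
      using J_lower[of "T (L x)"] by (simp add: JT)
    also have "\<dots> \<le> (C * sup_norm_on S x) / (1 - lam)"
      using L_bound[OF x] \<open>lam < 1\<close> by (intro divide_right_mono) auto
    finally have "(1 + \<bar>M\<bar>) * norm (T (L x)) \<le> (1 + \<bar>M\<bar>) * ((C * sup_norm_on S x) / (1 - lam))"
      by (intro mult_left_mono) auto
    then show "sup_norm_on S (d (T (L x))) \<le> (1 + \<bar>M\<bar>) * (C / (1 - lam)) * sup_norm_on S x"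
      using d_bound[of "T (L x)"] by simp
  qed
  have im: "im = coboundaries \<pi>"
  proof -
    have "d v \<in> im" for v
      using TJ[of v] d(1)[of v] unfolding J_def by (intro image_eqI[of _ _ "d v"]) auto
    then show ?thesis unfolding coboundaries_def d_def by blast
  qed
  show ?thesis
    unfolding cocycles_decompose_def cocycle_topology_def im[symmetric]
    using subspace_im closedin_im subspace_ker closedin_ker direct_sum ker_isomorphic_quotient by blast
qed

section \<open>Bochner integrals\<close>

text \<open>Banach-Steinhaus by Baire category: some \<open>A n\<close> has interior, and
  differences of its points fill a ball around \<open>0\<close>. It provides one bound for all
  \<open>\<pi> s\<close> with \<open>s\<close> in the compact set \<open>S\<close>, where strong
  continuity gives only pointwise bounds.\<close>

lemma uniform_boundedness:
  fixes T :: "'i \<Rightarrow> 'e::banach \<Rightarrow> 'f::real_normed_vector"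
  assumes lin: "\<And>i. i \<in> I \<Longrightarrow> bounded_linear (T i)"
    and pointwise: "\<And>v. \<exists>c. \<forall>i\<in>I. norm (T i v) \<le> c"
  obtains M where "\<And>i v. i \<in> I \<Longrightarrow> norm (T i v) \<le> M * norm v"
proof -
  define A where "A n = {v. \<forall>i\<in>I. norm (T i v) \<le> real n}" for n
  have closed: "closed (A n)" for n
  proof -
    have "A n = (\<Inter>i\<in>I. {v. norm (T i v) \<le> real n})" by (auto simp: A_def)
    then show ?thesis
      by (auto intro!: closed_Collect_le continuous_on_norm continuous_on_const linear_continuous_on[OF lin])
  qed
  have "\<exists>n. v \<in> A n" for v
  proof -
    obtain c where c: "\<forall>i\<in>I. norm (T i v) \<le> c" using pointwise by blast
    obtain n where "c \<le> real n" using real_arch_simple by blast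
    then show ?thesis unfolding A_def using c by (auto intro: order_trans)
  qed
  then have "\<Union>(range A) = UNIV" by auto
  moreover have "completely_metrizable_space (euclidean :: 'e topology)"
    by (rule completely_metrizable_space_euclidean)
  ultimately obtain n where "interior (A n) \<noteq> {}"
    using Baire_category_alt[of "euclidean :: 'e topology" "range A"] closed by fastforce
  then obtain x e where "e > 0" and e: "ball x e \<subseteq> A n"
    by (auto simp: mem_interior)
  define r where "r = e / 2"
  have r: "r > 0" "r < e" using \<open>e > 0\<close> by (auto simp: r_def)
  show ?thesis
  proof
    fix i v assume "i \<in> I"
    interpret bounded_linear "T i" by (rule lin[OF \<open>i \<in> I\<close>])
    show "norm (T i v) \<le> (2 * real n / r) * norm v"
    proof (cases "v = 0")
      case False
      \<comment> \<open>As \<open>r < e\<close>, both \<open>x\<close> and \<open>x + u\<close> lie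
        in \<open>A n\<close>, so \<open>T i u\<close> is a difference of two vectors of norm at
        most \<open>n\<close>.\<close>
      define u where "u = (r / norm v) *\<^sub>R v"
      have "norm u = r" using False r by (simp add: u_def)
      then have "x + u \<in> A n" "x \<in> A n" using e r by (auto simp: subset_iff dist_norm)
      then have "norm (T i (x + u)) \<le> n" "norm (T i x) \<le> n" using \<open>i \<in> I\<close> by (auto simp: A_def)
      then have "norm (T i u) \<le> 2 * n"
        using norm_triangle_ineq4[of "T i (x + u)" "T i x"] by (simp add: add)
      moreover have "norm (T i u) = r / norm v * norm (T i v)"
        using r by (simp add: u_def scaleR)
      ultimately show ?thesis using False r by (simp add: field_simps)
    qed (simp add: zero)
  qed
qed

text \<open>In a non-separable space a difference of Borel maps need not be Borel. Here
  \<open>s\<close> has finitely many values, and for each fixed value the norm is a continuous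
  function of \<open>f x\<close>.\<close>

lemma borel_measurable_norm_diff_simple:
  fixes f s :: "'a \<Rightarrow> 'e::real_normed_vector"
  assumes f: "f \<in> borel_measurable M" and s: "simple_function M s"
  shows "(\<lambda>x. norm (f x - s x)) \<in> borel_measurable M"
proof (rule measurable_compose_countable'[of "s ` space M" "\<lambda>y x. norm (f x - y)"])
  show "(\<lambda>x. norm (f x - y)) \<in> borel_measurable M" for y
    by (rule measurable_compose[OF f, of "\<lambda>e. norm (e - y)"])
       (intro borel_measurable_continuous_onI continuous_intros)
  show "s \<in> M \<rightarrow>\<^sub>M count_space (s ` space M)"
    using s by (auto simp: measurable_count_space_eq2 simple_function_def)
qed (use s in \<open>auto simp: simple_function_def intro: countable_finite\<close>)

text \<open>The triangle inequality through \<open>f\<close>. It yields uniqueness of the integral,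
  the Cauchy property of approximating integrals, and, with \<open>t = 0\<close>, the norm
  bound.\<close>

lemma norm_diff_simple_bochner_integral_le:
  fixes f :: "'a \<Rightarrow> 'e::real_normed_vector"
  assumes f: "f \<in> borel_measurable M"
    and s: "Bochner_Integration.simple_bochner_integrable M s"
    and t: "Bochner_Integration.simple_bochner_integrable M t"
  shows "ennreal (norm (Bochner_Integration.simple_bochner_integral M s
      - Bochner_Integration.simple_bochner_integral M t))
    \<le> (\<integral>\<^sup>+ x. norm (f x - s x) \<partial>M) + (\<integral>\<^sup>+ x. norm (f x - t x) \<partial>M)"
    (is "ennreal (norm (?s - ?t)) \<le> _")
proof -
  have [measurable]: "(\<lambda>x. norm (f x - s x)) \<in> borel_measurable M" "(\<lambda>x. norm (f x - t x)) \<in> borel_measurable M"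
    using s t f by (auto intro: borel_measurable_norm_diff_simple
      elim: Bochner_Integration.simple_bochner_integrable.cases)
  have "ennreal (norm (?s - ?t)) = norm (Bochner_Integration.simple_bochner_integral M (\<lambda>x. s x - t x))"
    using s t by (subst simple_bochner_integral_diff) auto
  also have "\<dots> \<le> Bochner_Integration.simple_bochner_integral M (\<lambda>x. norm (s x - t x))"
    using simple_bochner_integrable_compose2[of "(-)" M "s" "t"] s t
    by (auto intro!: simple_bochner_integral_norm_bound)
  also have "\<dots> = (\<integral>\<^sup>+x. norm (s x - t x) \<partial>M)"
    using simple_bochner_integrable_compose2[of "\<lambda>x y. norm (x - y)" M "s" "t"] s t
    by (auto intro!: simple_bochner_integral_eq_nn_integral)
  also have "\<dots> \<le> (\<integral>\<^sup>+x. ennreal (norm (f x - s x)) + ennreal (norm (f x - t x)) \<partial>M)"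
  proof (rule nn_integral_mono)
    fix x
    have "norm (s x - t x) \<le> norm (f x - s x) + norm (f x - t x)"
      using norm_triangle_ineq4[of "f x - t x" "f x - s x"] by simp
    then show "ennreal (norm (s x - t x)) \<le> ennreal (norm (f x - s x)) + ennreal (norm (f x - t x))"
      by (simp flip: ennreal_plus)
  qed
  also have "\<dots> = (\<integral>\<^sup>+ x. norm (f x - s x) \<partial>M) + (\<integral>\<^sup>+ x. norm (f x - t x) \<partial>M)"
    by (rule nn_integral_add) auto
  finally show ?thesis .
qed

lemma has_general_bochner_integral_unique:
  assumes "has_general_bochner_integral M f x" "has_general_bochner_integral M f y"
  shows "x = y"
proof -
  obtain s t where f: "f \<in> borel_measurable M"
    and st: "\<And>i. Bochner_Integration.simple_bochner_integrable M (s i)"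
      "\<And>i. Bochner_Integration.simple_bochner_integrable M (t i)"
    and lim: "(\<lambda>i. \<integral>\<^sup>+y. norm (f y - s i y) \<partial>M) \<longlonglongrightarrow> 0" "(\<lambda>i. \<integral>\<^sup>+y. norm (f y - t i y) \<partial>M) \<longlonglongrightarrow> 0"
      "(\<lambda>i. Bochner_Integration.simple_bochner_integral M (s i)) \<longlonglongrightarrow> x"
      "(\<lambda>i. Bochner_Integration.simple_bochner_integral M (t i)) \<longlonglongrightarrow> y"
    using assms unfolding has_general_bochner_integral_def by blast
  have 1: "(\<lambda>i. ennreal (norm (Bochner_Integration.simple_bochner_integral M (s i)
      - Bochner_Integration.simple_bochner_integral M (t i)))) \<longlonglongrightarrow> ennreal (norm (x - y))"
    using lim by (intro tendsto_intros) auto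
  have 2: "(\<lambda>i. (\<integral>\<^sup>+y. norm (f y - s i y) \<partial>M) + (\<integral>\<^sup>+y. norm (f y - t i y) \<partial>M)) \<longlonglongrightarrow> 0 + 0"
    using lim by (intro tendsto_intros) auto
  have "ennreal (norm (x - y)) \<le> 0 + 0"
    using norm_diff_simple_bochner_integral_le[OF f st] by (intro LIMSEQ_le[OF 1 2]) blast
  then show ?thesis by simp
qed

lemma general_bochner_integral_eq:
  "has_general_bochner_integral M f x \<Longrightarrow> general_bochner_integral M f = x"
  unfolding general_bochner_integral_def using has_general_bochner_integral_unique by blast

text \<open>Measurability of the sum is assumed because it does not follow from that of the summands
  without separability; for continuous functions it is immediate.\<close>

lemma has_general_bochner_integral_add:
  assumes f: "has_general_bochner_integral M f x" and g: "has_general_bochner_integral M g y"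
    and fg: "(\<lambda>x. f x + g x) \<in> borel_measurable M"
  shows "has_general_bochner_integral M (\<lambda>x. f x + g x) (x + y)"
proof -
  obtain s where s: "\<And>i. Bochner_Integration.simple_bochner_integrable M (s i)"
      "(\<lambda>i. \<integral>\<^sup>+y. norm (f y - s i y) \<partial>M) \<longlonglongrightarrow> 0"
      "(\<lambda>i. Bochner_Integration.simple_bochner_integral M (s i)) \<longlonglongrightarrow> x"
    and f[measurable]: "f \<in> borel_measurable M"
    using f unfolding has_general_bochner_integral_def by blast
  obtain t where t: "\<And>i. Bochner_Integration.simple_bochner_integrable M (t i)"
      "(\<lambda>i. \<integral>\<^sup>+y. norm (g y - t i y) \<partial>M) \<longlonglongrightarrow> 0"
      "(\<lambda>i. Bochner_Integration.simple_bochner_integral M (t i)) \<longlonglongrightarrow> y"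
    and g[measurable]: "g \<in> borel_measurable M"
    using g unfolding has_general_bochner_integral_def by blast
  have sf: "simple_function M (s i)" "simple_function M (t i)" for i
    using s(1) t(1) by (auto elim: Bochner_Integration.simple_bochner_integrable.cases)
  have "(\<integral>\<^sup>+u. norm (f u + g u - (s i u + t i u)) \<partial>M)
      \<le> (\<integral>\<^sup>+u. norm (f u - s i u) \<partial>M) + (\<integral>\<^sup>+u. norm (g u - t i u) \<partial>M)" for i
  proof -
    have "(\<integral>\<^sup>+u. norm (f u + g u - (s i u + t i u)) \<partial>M)
        \<le> (\<integral>\<^sup>+u. ennreal (norm (f u - s i u)) + ennreal (norm (g u - t i u)) \<partial>M)"
      by (auto intro!: nn_integral_mono norm_diff_triangle_ineq simp flip: ennreal_plus)
    also have "\<dots> = (\<integral>\<^sup>+u. norm (f u - s i u) \<partial>M) + (\<integral>\<^sup>+u. norm (g u - t i u) \<partial>M)"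
      using borel_measurable_norm_diff_simple[OF f sf(1)] borel_measurable_norm_diff_simple[OF g sf(2)]
      by (intro nn_integral_add) auto
    finally show ?thesis .
  qed
  moreover have 0: "(\<lambda>i. (\<integral>\<^sup>+u. norm (f u - s i u) \<partial>M) + (\<integral>\<^sup>+u. norm (g u - t i u) \<partial>M)) \<longlonglongrightarrow> 0"
    using tendsto_add[OF s(2) t(2)] by simp
  ultimately have "(\<lambda>i. \<integral>\<^sup>+u. norm (f u + g u - (s i u + t i u)) \<partial>M) \<longlonglongrightarrow> 0"
    by (intro tendsto_sandwich[OF _ _ tendsto_const 0] always_eventually allI) simp
  moreover have "(\<lambda>i. Bochner_Integration.simple_bochner_integral M (\<lambda>u. s i u + t i u)) \<longlonglongrightarrow> x + y"
    using tendsto_add[OF s(3) t(3)] by (simp add: simple_bochner_integral_add s(1) t(1))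
  moreover have "Bochner_Integration.simple_bochner_integrable M (\<lambda>u. s i u + t i u)" for i
    using s(1) t(1) by (simp add: simple_bochner_integrable_compose2)
  ultimately show ?thesis
    unfolding has_general_bochner_integral_def using fg
    by (intro conjI exI[of _ "\<lambda>i u. s i u + t i u"] allI)
qed

lemma has_general_bochner_integral_scaleR:
  assumes f: "has_general_bochner_integral M f x"
  shows "has_general_bochner_integral M (\<lambda>x. r *\<^sub>R f x) (r *\<^sub>R x)"
proof -
  obtain s where s: "\<And>i. Bochner_Integration.simple_bochner_integrable M (s i)"
      "(\<lambda>i. \<integral>\<^sup>+y. norm (f y - s i y) \<partial>M) \<longlonglongrightarrow> 0"
      "(\<lambda>i. Bochner_Integration.simple_bochner_integral M (s i)) \<longlonglongrightarrow> x"
    and f[measurable]: "f \<in> borel_measurable M"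
    using f unfolding has_general_bochner_integral_def by blast
  have [measurable]: "(\<lambda>u. norm (f u - s i u)) \<in> borel_measurable M" for i
    using s(1) borel_measurable_norm_diff_simple[OF f]
    by (auto elim: Bochner_Integration.simple_bochner_integrable.cases)
  have "(\<integral>\<^sup>+u. norm (r *\<^sub>R f u - r *\<^sub>R s i u) \<partial>M) = ennreal \<bar>r\<bar> * (\<integral>\<^sup>+u. norm (f u - s i u) \<partial>M)" for i
    by (subst nn_integral_cmult[symmetric]) (auto simp flip: ennreal_mult scaleR_diff_right)
  moreover have "(\<lambda>i. ennreal \<bar>r\<bar> * (\<integral>\<^sup>+u. norm (f u - s i u) \<partial>M)) \<longlonglongrightarrow> 0"
    using ennreal_tendsto_cmult[OF _ s(2), of "ennreal \<bar>r\<bar>"] by simp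
  ultimately have "(\<lambda>i. \<integral>\<^sup>+u. norm (r *\<^sub>R f u - r *\<^sub>R s i u) \<partial>M) \<longlonglongrightarrow> 0"
    by simp
  moreover have "(\<lambda>i. Bochner_Integration.simple_bochner_integral M (\<lambda>u. r *\<^sub>R s i u)) \<longlonglongrightarrow> r *\<^sub>R x"
    using tendsto_scaleR[OF tendsto_const s(3), of r]
    by (simp add: simple_bochner_integral_linear[OF _ s(1), of "\<lambda>u. r *\<^sub>R u"] linear_scale_self)
  moreover have "Bochner_Integration.simple_bochner_integrable M (\<lambda>u. r *\<^sub>R s i u)" for i
    using simple_bochner_integrable_compose2[of "\<lambda>u v. r *\<^sub>R u", OF _ s(1) s(1)] by simp
  moreover have "(\<lambda>u. r *\<^sub>R f u) \<in> borel_measurable M"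
    by (rule measurable_compose[OF f]) (intro borel_measurable_continuous_onI continuous_intros)
  ultimately show ?thesis
    unfolding has_general_bochner_integral_def
    by (intro conjI exI[of _ "\<lambda>i u. r *\<^sub>R s i u"] allI)
qed

context prob_space
begin

lemma has_general_bochner_integral_const: "has_general_bochner_integral M (\<lambda>_. v) v"
proof -
  have "Bochner_Integration.simple_bochner_integrable M (\<lambda>_. v)"
    by (auto intro!: Bochner_Integration.simple_bochner_integrable.intros simp: emeasure_space_1)
  moreover have "Bochner_Integration.simple_bochner_integral M (\<lambda>_. v) = v"
    using not_empty by (simp add: Bochner_Integration.simple_bochner_integral_def image_constant_conv prob_space)
  ultimately show ?thesis
    unfolding has_general_bochner_integral_def by (auto intro!: exI[of _ "\<lambda>_ _. v"])
qed

lemma norm_general_bochner_integral_le: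
  assumes "has_general_bochner_integral M f x" and le: "AE u in M. norm (f u) \<le> c" and "0 \<le> c"
  shows "norm x \<le> c"
proof -
  obtain s where s: "\<And>i. Bochner_Integration.simple_bochner_integrable M (s i)"
      "(\<lambda>i. \<integral>\<^sup>+y. norm (f y - s i y) \<partial>M) \<longlonglongrightarrow> 0"
      "(\<lambda>i. Bochner_Integration.simple_bochner_integral M (s i)) \<longlonglongrightarrow> x"
    and f: "f \<in> borel_measurable M"
    using assms unfolding has_general_bochner_integral_def by blast
  \<comment> \<open>Comparison with the zero simple function turns the difference estimate into a
    norm estimate.\<close>
  have zero: "Bochner_Integration.simple_bochner_integrable M (\<lambda>_. 0 :: 'b)"
    "Bochner_Integration.simple_bochner_integral M (\<lambda>_. 0 :: 'b) = 0"
    using not_empty by (auto intro!: Bochner_Integration.simple_bochner_integrable.intros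
        simp: Bochner_Integration.simple_bochner_integral_def image_constant_conv)
  have "(\<integral>\<^sup>+u. norm (f u) \<partial>M) \<le> (\<integral>\<^sup>+u. ennreal c \<partial>M)"
    using le by (intro nn_integral_mono_AE) (auto elim!: eventually_mono intro: ennreal_leI)
  then have fc: "(\<integral>\<^sup>+u. norm (f u) \<partial>M) \<le> ennreal c" by (simp add: emeasure_space_1)
  have "ennreal (norm (Bochner_Integration.simple_bochner_integral M (s i)))
      \<le> (\<integral>\<^sup>+u. norm (f u - s i u) \<partial>M) + ennreal c" for i
    using norm_diff_simple_bochner_integral_le[OF f s(1) zero(1), of i] fc
    by (simp add: zero(2)) (meson add_left_mono order_trans)
  moreover have 1: "(\<lambda>i. ennreal (norm (Bochner_Integration.simple_bochner_integral M (s i)))) \<longlonglongrightarrow> ennreal (norm x)"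
    using s by (intro tendsto_intros) auto
  moreover have 2: "(\<lambda>i. (\<integral>\<^sup>+u. norm (f u - s i u) \<partial>M) + ennreal c) \<longlonglongrightarrow> 0 + ennreal c"
    using s by (intro tendsto_intros) auto
  ultimately have "ennreal (norm x) \<le> 0 + ennreal c" by (intro LIMSEQ_le[OF 1 2]) blast
  then show ?thesis using \<open>0 \<le> c\<close> by simp
qed

text \<open>Total boundedness of \<open>K\<close> gives simple functions that are uniformly close to
  \<open>f\<close> wherever \<open>f\<close> lies in \<open>K\<close>; their integrals form a Cauchy
  sequence in the complete space.\<close>

lemma has_general_bochner_integral_exists:
  fixes f :: "'a \<Rightarrow> 'e::banach"
  assumes f: "f \<in> borel_measurable M" and K: "compact K" and fK: "AE u in M. f u \<in> K"
  shows "\<exists>x. has_general_bochner_integral M f x"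
proof -
  \<comment> \<open>Induction over the centres: on the preimage of the new ball the approximating
    function is overwritten by the new centre.\<close>
  have simple: "\<exists>s. simple_function M s \<and> (\<forall>u. f u \<in> (\<Union>x\<in>k. ball x e) \<longrightarrow> norm (f u - s u) < e)"
    if "finite k" for k and e :: real
    using that
  proof induction
    case (insert c k)
    then obtain s where s: "simple_function M s" "\<forall>u. f u \<in> (\<Union>x\<in>k. ball x e) \<longrightarrow> norm (f u - s u) < e"
      by blast
    have "simple_function M (\<lambda>u. if u \<in> f -` ball c e then c else s u)"
      using s(1) measurable_sets[OF f, of "ball c e"] by (intro simple_function_If_set) auto
    then show ?case
      using s(2) by (intro exI conjI) (auto simp: dist_norm norm_minus_commute)
  qed (intro exI[of _ "\<lambda>_. 0"], auto)
  obtain e :: "nat \<Rightarrow> real" where e: "\<And>i. e i > 0" "e \<longlonglongrightarrow> 0"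
    using LIMSEQ_inverse_real_of_nat by (metis inverse_positive_iff_positive of_nat_0_less_iff zero_less_Suc)
  have "\<exists>s. simple_function M s \<and> (\<forall>u. f u \<in> K \<longrightarrow> norm (f u - s u) < e i)" for i
  proof -
    obtain k where "finite k" "K \<subseteq> (\<Union>x\<in>k. ball x (e i))"
      using K e(1) unfolding compact_eq_totally_bounded by blast
    then show ?thesis using simple[of k "e i"] by blast
  qed
  then obtain s where s: "\<And>i. simple_function M (s i)"
    "\<And>i u. f u \<in> K \<Longrightarrow> norm (f u - s i u) < e i" by metis
  have sb: "Bochner_Integration.simple_bochner_integrable M (s i)" for i
    using s(1) by (auto intro!: Bochner_Integration.simple_bochner_integrable.intros)
  have le: "(\<integral>\<^sup>+u. norm (f u - s i u) \<partial>M) \<le> ennreal (e i)" for i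
  proof -
    have "AE u in M. ennreal (norm (f u - s i u)) \<le> ennreal (e i)"
      using fK by eventually_elim (intro ennreal_leI less_imp_le s(2))
    then have "(\<integral>\<^sup>+u. norm (f u - s i u) \<partial>M) \<le> (\<integral>\<^sup>+u. ennreal (e i) \<partial>M)"
      by (rule nn_integral_mono_AE)
    then show ?thesis by (simp add: emeasure_space_1)
  qed
  have e0: "(\<lambda>i. ennreal (e i)) \<longlonglongrightarrow> 0"
    using tendsto_ennrealI[OF e(2)] by simp
  have lim: "(\<lambda>i. \<integral>\<^sup>+u. norm (f u - s i u) \<partial>M) \<longlonglongrightarrow> 0"
    by (intro tendsto_sandwich[OF _ _ tendsto_const e0] always_eventually allI le) simp
  define I where "I i = Bochner_Integration.simple_bochner_integral M (s i)" for i
  have diff: "norm (I i - I j) \<le> e i + e j" for i j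
  proof -
    have "ennreal (norm (I i - I j)) \<le> ennreal (e i) + ennreal (e j)"
      unfolding I_def using norm_diff_simple_bochner_integral_le[OF f sb sb, of i j] add_mono[OF le le, of i j]
      by (rule order_trans)
    then show ?thesis using e(1)[THEN less_imp_le] by (simp flip: ennreal_plus)
  qed
  have "Cauchy I"
  proof (rule metric_CauchyI)
    fix r :: real assume "r > 0"
    then obtain n where n: "\<And>i. i \<ge> n \<Longrightarrow> e i < r / 2"
      using order_tendstoD(2)[OF e(2), of "r / 2"] by (auto simp: eventually_sequentially)
    show "\<exists>n. \<forall>i\<ge>n. \<forall>j\<ge>n. dist (I i) (I j) < r"
    proof (intro exI[of _ n] allI impI)
      fix i j assume "i \<ge> n" "j \<ge> n"
      then show "dist (I i) (I j) < r"
        unfolding dist_norm using diff[of i j] n[of i] n[of j] by linarith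
    qed
  qed
  then obtain x where "I \<longlonglongrightarrow> x" using Cauchy_convergent convergentD by blast
  then show ?thesis
    unfolding has_general_bochner_integral_def I_def using f sb lim by blast
qed

end

section \<open>Concentration on the support, and the Markov operator\<close>

lemma has_continuous_compact_density_sets:
  "has_continuous_compact_density \<mu> \<Longrightarrow> sets \<mu> = sets borel"
  by (auto simp: has_continuous_compact_density_def left_haar_measure_def)

text \<open>The complement of the support is a union of possibly uncountably many null open sets.
  Compact subsets of \<open>U\<close> need only finitely many of them, and inner regularity of Haar
  measure on the open set \<open>U\<close> passes from these to \<open>U\<close> itself.\<close>

lemma AE_measure_supp_subset:
  fixes \<mu> :: "'g::{topological_group_add, t2_space} measure"
  assumes "has_continuous_compact_density \<mu>" and supp: "measure_supp \<mu> \<subseteq> S" and "closed S"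
  shows "AE g in \<mu>. g \<in> S"
proof -
  obtain m \<phi> where m: "left_haar_measure m" and \<phi>: "continuous_on UNIV \<phi>" "\<And>g. 0 \<le> \<phi> g"
    and \<mu>: "\<mu> = density m (\<lambda>g. ennreal (\<phi> g))"
    using assms(1) unfolding has_continuous_compact_density_def by blast
  have sets_m: "sets m = sets borel"
    using m by (simp add: left_haar_measure_def)
  have \<phi>_meas: "(\<lambda>g. ennreal (\<phi> g)) \<in> borel_measurable m"
    using borel_measurable_continuous_onI[OF \<phi>(1)] by (simp add: measurable_cong_sets[OF sets_m refl])
  define U where "U = {g. 0 < \<phi> g} \<inter> - S"
  have "open U"
    unfolding U_def using \<phi>(1) \<open>closed S\<close> by (intro open_Int open_Collect_less) auto
  have "emeasure m K = 0" if K: "compact K" "K \<subseteq> U" for K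
  proof -
    have "\<exists>W. open W \<and> g \<in> W \<and> emeasure \<mu> W = 0" if "g \<in> K" for g
      using that K supp unfolding U_def measure_supp_def by blast
    then obtain W where W: "\<And>g. g \<in> K \<Longrightarrow> open (W g) \<and> g \<in> W g \<and> emeasure \<mu> (W g) = 0"
      by metis
    obtain F where F: "F \<subseteq> K" "finite F" "K \<subseteq> (\<Union>g\<in>F. W g)"
      using compactE_image[OF K(1), of K W] W by blast
    have borel: "A \<in> sets \<mu>" if "open A \<or> closed A" for A
      unfolding has_continuous_compact_density_sets[OF assms(1)] using that borel_open borel_closed by blast
    have "(\<Union>g\<in>F. W g) \<in> null_sets \<mu>"
      using F W borel by (intro null_sets_UN' countable_finite) (auto simp: null_sets_def)
    then have "K \<in> null_sets \<mu>"
      using F borel compact_imp_closed[OF K(1)] null_sets_subset by blast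
    \<comment> \<open>The density is positive on \<open>K\<close>, so a \<open>\<mu>\<close>-null
      \<open>K\<close> is also null for Haar measure.\<close>
    then have "AE g in m. g \<in> K \<longrightarrow> \<phi> g = 0"
      unfolding \<mu> null_sets_density_iff[OF \<phi>_meas] using \<phi>(2) by (auto simp: ennreal_eq_0_iff antisym)
    then have "AE g in m. g \<notin> K"
      by eventually_elim (use K in \<open>auto simp: U_def\<close>)
    then show ?thesis
      using compact_imp_closed[OF K(1)] sets_m sets_eq_imp_space_eq[OF sets_m]
      by (subst (asm) AE_iff_measurable[of K]) auto
  qed
  then have "(SUP K\<in>{K. compact K \<and> K \<subseteq> U}. emeasure m K) = 0"
    by (auto simp: SUP_eq_const intro!: SUP_eq_const exI[of _ "{}"])
  moreover have "emeasure m U = (SUP K\<in>{K. compact K \<and> K \<subseteq> U}. emeasure m K)"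
    using m \<open>open U\<close> unfolding left_haar_measure_def by blast
  ultimately have "emeasure m U = 0" by (rule trans[rotated])
  then have "U \<in> null_sets m"
    using \<open>open U\<close> sets_m by (auto simp: null_sets_def)
  then have "AE g in m. g \<notin> U"
    by (rule AE_not_in)
  then have "AE g in m. g \<in> - S \<longrightarrow> ennreal (\<phi> g) = 0"
    by eventually_elim (use \<phi>(2) in \<open>auto simp: U_def ennreal_eq_0_iff not_less\<close>)
  then have "- S \<in> null_sets \<mu>"
    unfolding \<mu> null_sets_density_iff[OF \<phi>_meas] using \<open>closed S\<close> sets_m by auto
  then show ?thesis
    using AE_not_in by fastforce
qed

text \<open>As \<open>\<mu>\<close> is concentrated on the compact set \<open>S\<close>, every
  continuous function has an integral bounded by its supremum over \<open>S\<close>; for cocycles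
  this is the bound required of \<open>L\<close>.\<close>

lemma cocycles_decompose_if_markov_contraction:
  fixes S :: "'g::{topological_group_add, t2_space} set"
    and \<pi> :: "'g \<Rightarrow> 'e::banach \<Rightarrow> 'e"
  assumes S: "compact S" "generates_group S" and \<pi>: "strongly_continuous_rep \<pi>"
    and "prob_space \<mu>" and \<mu>: "has_continuous_compact_density \<mu>" "measure_supp \<mu> \<subseteq> S"
    and contraction: "onorm (markov_operator \<mu> \<pi>) \<le> lam" "lam < 1"
  shows "cocycles_decompose S \<pi>"
proof -
  interpret prob_space \<mu> by fact
  have \<pi>_lin: "bounded_linear (\<pi> g)" and \<pi>_cont: "continuous_on UNIV (\<lambda>g. \<pi> g v)" for g v
    using \<pi> by (simp_all add: strongly_continuous_rep_def)
  have meas: "f \<in> borel_measurable \<mu>" if "continuous_on UNIV f" for f :: "'g \<Rightarrow> 'e"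
    using borel_measurable_continuous_onI[OF that]
    by (simp add: measurable_cong_sets[OF has_continuous_compact_density_sets[OF \<mu>(1)] refl])
  have AE_S: "AE g in \<mu>. g \<in> S"
    by (rule AE_measure_supp_subset[OF \<mu> compact_imp_closed[OF S(1)]])
  have bochner: "has_general_bochner_integral \<mu> f (general_bochner_integral \<mu> f)"
    if "continuous_on UNIV f" for f :: "'g \<Rightarrow> 'e"
  proof -
    have "compact (f ` S)"
      by (intro compact_continuous_image S(1) continuous_on_subset[OF that subset_UNIV])
    moreover have "AE g in \<mu>. f g \<in> f ` S"
      using AE_S by eventually_elim simp
    ultimately show ?thesis
      using has_general_bochner_integral_exists[OF meas[OF that]] general_bochner_integral_eq by metis
  qed
  have add: "general_bochner_integral \<mu> (\<lambda>g. f g + h g) = general_bochner_integral \<mu> f + general_bochner_integral \<mu> h"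
    if "continuous_on UNIV f" "continuous_on UNIV h" for f h :: "'g \<Rightarrow> 'e"
    using that by (intro general_bochner_integral_eq has_general_bochner_integral_add bochner meas continuous_intros)
  have scale: "general_bochner_integral \<mu> (\<lambda>g. r *\<^sub>R f g) = r *\<^sub>R general_bochner_integral \<mu> f"
    if "continuous_on UNIV f" for f :: "'g \<Rightarrow> 'e" and r
    using that by (intro general_bochner_integral_eq has_general_bochner_integral_scaleR bochner)
  have le: "norm (general_bochner_integral \<mu> f) \<le> c"
    if "continuous_on UNIV f" "0 \<le> c" "\<And>s. s \<in> S \<Longrightarrow> norm (f s) \<le> c" for f :: "'g \<Rightarrow> 'e" and c
  proof (rule norm_general_bochner_integral_le[OF bochner[OF that(1)] _ that(2)])
    show "AE g in \<mu>. norm (f g) \<le> c"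
      using AE_S by eventually_elim (rule that(3))
  qed
  have "\<exists>c. \<forall>s\<in>S. norm (\<pi> s v) \<le> c" for v
    using norm_le_sup_norm_on[OF S(1) \<pi>_cont, of _ v] by blast
  then obtain M where M: "\<And>s v. s \<in> S \<Longrightarrow> norm (\<pi> s v) \<le> M * norm v"
    using uniform_boundedness[of S \<pi>] \<pi>_lin by blast
  have M': "norm (\<pi> s v) \<le> \<bar>M\<bar> * norm v" if "s \<in> S" for s v
    using M[OF that, of v] by (rule order_trans) (simp add: mult_right_mono)
  \<comment> \<open>\<open>onorm\<close> controls the values only once the operator is known to be
    bounded and linear.\<close>
  have "bounded_linear (markov_operator \<mu> \<pi>)"
  proof (rule bounded_linear_intro[where K = "\<bar>M\<bar>"])
    show "markov_operator \<mu> \<pi> (v + w) = markov_operator \<mu> \<pi> v + markov_operator \<mu> \<pi> w" for v w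
      unfolding markov_operator_def linear_simps(1)[OF \<pi>_lin] by (rule add[OF \<pi>_cont \<pi>_cont])
    show "markov_operator \<mu> \<pi> (r *\<^sub>R v) = r *\<^sub>R markov_operator \<mu> \<pi> v" for r v
      unfolding markov_operator_def linear_simps(5)[OF \<pi>_lin] by (rule scale[OF \<pi>_cont])
    show "norm (markov_operator \<mu> \<pi> v) \<le> norm v * \<bar>M\<bar>" for v
      unfolding markov_operator_def by (rule le[OF \<pi>_cont]) (use M' in \<open>auto simp: mult.commute\<close>)
  qed
  then have markov: "norm (markov_operator \<mu> \<pi> v) \<le> lam * norm v" for v
    using onorm[of "markov_operator \<mu> \<pi>" v] mult_right_mono[OF contraction(1) norm_ge_zero[of v]] by linarith
  have cont: "continuous_on UNIV z" if "z \<in> cocycles \<pi>" for z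
    using that by (simp add: cocycles_def)
  show ?thesis
  proof (rule cocycles_decomposeI[OF \<pi> S, where L = "general_bochner_integral \<mu>" and C = 1 and M = M and lam = lam])
    show "general_bochner_integral \<mu> (z + w) = general_bochner_integral \<mu> z + general_bochner_integral \<mu> w"
      if "z \<in> cocycles \<pi>" "w \<in> cocycles \<pi>" for z w
      using add[OF cont cont, OF that] by (simp add: plus_fun_def)
    show "general_bochner_integral \<mu> (r *\<^sub>R z) = r *\<^sub>R general_bochner_integral \<mu> z"
      if "z \<in> cocycles \<pi>" for r z
      using scale[OF cont, OF that] by (simp add: scaleR_fun_def)
    show "norm (general_bochner_integral \<mu> z) \<le> 1 * sup_norm_on S z" if "z \<in> cocycles \<pi>" for z
      using le[OF cont[OF that]] norm_le_sup_norm_on[OF S(1) cont[OF that]] sup_norm_on_nonneg[OF S(1) cont[OF that]]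
      by simp
    show "norm (v - general_bochner_integral \<mu> (codifferential \<pi> v)) \<le> lam * norm v" for v
    proof -
      have "general_bochner_integral \<mu> (\<lambda>g. v + (-1) *\<^sub>R \<pi> g v)
          = general_bochner_integral \<mu> (\<lambda>_. v) + (-1) *\<^sub>R markov_operator \<mu> \<pi> v"
        unfolding markov_operator_def scale[OF \<pi>_cont, symmetric]
        by (intro add continuous_intros \<pi>_cont)
      then have "general_bochner_integral \<mu> (codifferential \<pi> v) = v - markov_operator \<mu> \<pi> v"
        using general_bochner_integral_eq[OF has_general_bochner_integral_const, of v]
        by (simp add: codifferential_def)
      then show ?thesis using markov by simp
    qed
  qed (use M contraction in auto)
qed

section \<open>Separated sets\<close>

lemma nhd_zero_operations:
  fixes U :: "'g::topological_group_add set"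
  assumes "open U" "0 \<in> U"
  obtains V where "open V" "0 \<in> V"
    "\<And>x y. x \<in> V \<Longrightarrow> y \<in> V \<Longrightarrow> x + y \<in> U \<and> x - y \<in> U \<and> - x + y \<in> U"
proof -
  define W where "W = (\<lambda>p. fst p + snd p) -` U \<inter> (\<lambda>p. fst p - snd p) -` U \<inter> (\<lambda>p. - fst p + snd p) -` U"
  have "open W"
    unfolding W_def by (intro open_Int open_vimage assms(1) continuous_intros)
  moreover have "(0, 0) \<in> W" using assms by (simp add: W_def)
  ultimately obtain A B where "open A" "open B" "(0, 0) \<in> A \<times> B" "A \<times> B \<subseteq> W"
    by (rule open_prod_elim)
  then show ?thesis
    by (intro that[of "A \<inter> B"]) (auto simp: W_def)
qed

lemma compact_cover_translates:
  fixes V :: "'g::topological_group_add set"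
  assumes "compact K" "open V" "0 \<in> V"
  obtains F where "finite F" "\<And>x. x \<in> K \<Longrightarrow> \<exists>f\<in>F. - f + x \<in> V"
proof -
  have "open ((\<lambda>x. - f + x) -` V)" for f
    by (intro open_vimage assms continuous_intros)
  moreover have "K \<subseteq> (\<Union>f\<in>K. (\<lambda>x. - f + x) -` V)"
    using assms by auto
  ultimately obtain F where "F \<subseteq> K" "finite F" "K \<subseteq> (\<Union>f\<in>F. (\<lambda>x. - f + x) -` V)"
    by (rule compactE_image[OF assms(1)])
  then show ?thesis by (intro that[of F]) auto
qed

text \<open>The difference \<open>- x + y\<close> is invariant under left translation. It is also
  the one seen by an orbit: \<open>\<pi> y v\<close> is \<open>\<pi> x\<close> applied to
  \<open>\<pi> (- x + y) v\<close>.\<close>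

definition separated :: "'g::group_add set \<Rightarrow> 'g set \<Rightarrow> bool"
  where "separated U p \<longleftrightarrow> (\<forall>x\<in>p. \<forall>y\<in>p. x \<noteq> y \<longrightarrow> - x + y \<notin> U)"

text \<open>Maximality refers to cardinality instead of inclusion, so that any separated set moved
  into \<open>X\<close> becomes a competitor.\<close>

definition max_separated :: "'g::group_add set \<Rightarrow> 'g set \<Rightarrow> 'g set \<Rightarrow> bool"
  where "max_separated U X p \<longleftrightarrow> p \<subseteq> X \<and> finite p \<and> separated U p \<and>
    (\<forall>q. q \<subseteq> X \<longrightarrow> finite q \<longrightarrow> separated U q \<longrightarrow> card q \<le> card p)"

lemma separated_subset: "separated U p \<Longrightarrow> q \<subseteq> p \<Longrightarrow> separated U q"
  unfolding separated_def by blast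

lemma separated_translate: "separated U p \<Longrightarrow> separated U ((+) s ` p)"
  unfolding separated_def by (auto simp: minus_add add.assoc simp del: add_uminus_conv_diff)

lemma card_translate: "card ((+) (s::'g::group_add) ` p) = card p"
  by (intro card_image) (auto simp: inj_on_def)

text \<open>Cover \<open>K\<close> by finitely many translates of a small \<open>V\<close>: each
  translate contains at most one point of a separated set, so cardinalities are bounded.\<close>

lemma max_separated_exists:
  fixes U :: "'g::topological_group_add set"
  assumes "compact K" "X \<subseteq> K" "open U" "0 \<in> U"
  shows "\<exists>p. max_separated U X p"
proof -
  obtain V where V: "open V" "0 \<in> V" "\<And>x y. x \<in> V \<Longrightarrow> y \<in> V \<Longrightarrow> - x + y \<in> U"
    using nhd_zero_operations[OF assms(3,4)] by metis
  obtain F where F: "finite F" "\<And>x. x \<in> K \<Longrightarrow> \<exists>f\<in>F. - f + x \<in> V"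
    using compact_cover_translates[OF assms(1) V(1,2)] by blast
  have bound: "card q \<le> card F" if q: "q \<subseteq> X" "separated U q" for q
  proof -
    obtain f where f: "\<And>x. x \<in> q \<Longrightarrow> f x \<in> F \<and> - f x + x \<in> V"
      using F(2) q(1) assms(2) by (metis subsetD)
    have "inj_on f q"
    proof (rule inj_onI)
      fix x y assume xy: "x \<in> q" "y \<in> q" "f x = f y"
      \<comment> \<open>Two points of the same translate of \<open>V\<close> differ by an element of
        \<open>- V + V\<close>, which lies in \<open>U\<close>.\<close>
      have "- x + y = - (- f x + x) + (- f x + y)" by (simp add: minus_add add.assoc)
      also have "\<dots> \<in> U" using V(3) f xy by metis
      finally show "x = y" using q(2) xy unfolding separated_def by blast
    qed
    then show ?thesis
      using f F(1) by (intro card_inj_on_le[of f]) auto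
  qed
  have "\<exists>p. (p \<subseteq> X \<and> finite p \<and> separated U p) \<and>
      (\<forall>q. q \<subseteq> X \<and> finite q \<and> separated U q \<longrightarrow> card q \<le> card p)"
    by (rule ex_has_greatest_nat[where k = "{}" and b = "Suc (card F)"])
       (auto simp: separated_def less_Suc_eq_le intro!: bound[unfolded separated_def])
  then show ?thesis unfolding max_separated_def by blast
qed

text \<open>Outside \<open>K\<close>, the separated set \<open>P \<union> (s + Q)\<close> stays away from \<open>W\<close>, so a maximal separated subset
  \<open>q\<close> of \<open>V\<close> can be added to it inside \<open>s + K\<close>; as translates of \<open>V\<close> cover \<open>K\<close>, the set \<open>q\<close> contains at
  least the proportion \<open>1 / card F\<close> of the points of \<open>p\<close>.\<close>

lemma separated_union_translate_card:
  fixes U :: "'g::group_add set"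
  assumes p: "max_separated U K p" and q: "max_separated U V q"
    and F: "finite F" "\<And>x. x \<in> K \<Longrightarrow> \<exists>f\<in>F. - f + x \<in> V"
    and "V \<subseteq> W" and VU: "\<And>x u. x \<in> V \<Longrightarrow> u \<in> U \<Longrightarrow> x + u \<in> W \<and> x - u \<in> W"
    and W: "W \<subseteq> K" "\<And>w. w \<in> W \<Longrightarrow> - s + w \<in> K"
    and P: "P \<subseteq> p" and Q: "Q \<subseteq> p"
    and sep: "separated U (P \<union> (+) s ` Q)" and disj: "P \<inter> (+) s ` Q = {}"
  shows "card F * (card P + card Q) + card p \<le> 2 * card F * card p"
proof -
  have pK: "p \<subseteq> K" and "finite p" and sep_p: "separated U p"
    and max_p: "\<And>r. r \<subseteq> K \<Longrightarrow> finite r \<Longrightarrow> separated U r \<Longrightarrow> card r \<le> card p"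
    using p unfolding max_separated_def by auto
  have qV: "q \<subseteq> V" and "finite q" and sep_q: "separated U q"
    and max_q: "\<And>r. r \<subseteq> V \<Longrightarrow> finite r \<Longrightarrow> separated U r \<Longrightarrow> card r \<le> card q"
    using q unfolding max_separated_def by auto
  define Z where "Z = P \<union> (+) s ` Q"
  have fin: "finite P" "finite Q" "finite Z"
    using P Q \<open>finite p\<close> by (auto simp: Z_def intro: finite_subset)
  have card_Z: "card Z = card P + card Q"
    using card_Un_disjoint[of P "(+) s ` Q"] fin disj by (simp add: Z_def card_translate)
  \<comment> \<open>The part of \<open>Z\<close> inside \<open>K\<close> competes with
    \<open>p\<close> directly; the part outside has to be moved first.\<close>
  have "card (Z \<inter> K) \<le> card p"
    using fin sep by (intro max_p) (auto simp: Z_def intro: separated_subset)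
  moreover have "card (Z - K) + card q \<le> card p"
  proof -
    have "separated U ((Z - K) \<union> q)"
      unfolding separated_def
    proof (intro ballI impI notI)
      fix x y assume x: "x \<in> (Z - K) \<union> q" and y: "y \<in> (Z - K) \<union> q" and "x \<noteq> y" and u: "- x + y \<in> U"
      consider "x \<in> Z" "y \<in> Z" | "x \<in> q" "y \<in> q" | "x \<in> Z - K" "y \<in> q" | "x \<in> q" "y \<in> Z - K"
        using x y by blast
      then show False
      proof cases
        case 1 then show False using sep \<open>x \<noteq> y\<close> u unfolding separated_def Z_def by blast
      next
        case 2 then show False using sep_q \<open>x \<noteq> y\<close> u unfolding separated_def by blast
      next
        case 3
        then have "y - (- x + y) \<in> W" using VU[OF _ u, of y] qV by blast
        then show False using 3 W(1) by (auto simp: diff_conv_add_uminus minus_add simp del: add_uminus_conv_diff)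
      next
        case 4
        then have "x + (- x + y) \<in> W" using VU[OF _ u, of x] qV by blast
        then show False using 4 W(1) by (auto simp flip: add.assoc)
      qed
    qed
    \<comment> \<open>Translation by \<open>- s\<close> brings the union into \<open>K\<close>: as
      \<open>P\<close> lies in \<open>K\<close>, a point of \<open>Z\<close> outside
      \<open>K\<close> has the form \<open>s + y\<close> with \<open>y\<close> in
      \<open>Q\<close>.\<close>
    then have "separated U ((+) (- s) ` ((Z - K) \<union> q))" by (rule separated_translate)
    moreover have "(+) (- s) ` ((Z - K) \<union> q) \<subseteq> K"
    proof safe
      fix x assume "x \<in> Z" "x \<notin> K"
      then obtain y where "y \<in> Q" "x = s + y" using P pK by (auto simp: Z_def)
      then show "- s + x \<in> K" using Q pK by (auto simp flip: add.assoc)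
    next
      fix x assume "x \<in> q" then show "- s + x \<in> K" using W(2) qV \<open>V \<subseteq> W\<close> by blast
    qed
    ultimately have "card ((Z - K) \<union> q) \<le> card p"
      using max_p[of "(+) (- s) ` ((Z - K) \<union> q)"] fin \<open>finite q\<close> by (simp add: card_translate)
    moreover have "(Z - K) \<inter> q = {}" using qV \<open>V \<subseteq> W\<close> W(1) by blast
    ultimately show ?thesis using card_Un_disjoint[of "Z - K" q] fin \<open>finite q\<close> by simp
  qed
  moreover have "card p \<le> card F * card q"
  proof -
    have "p \<subseteq> (\<Union>f\<in>F. {x \<in> p. - f + x \<in> V})" using F(2) pK by blast
    then have "card p \<le> card (\<Union>f\<in>F. {x \<in> p. - f + x \<in> V})"
      using F(1) \<open>finite p\<close> by (intro card_mono) auto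
    also have "\<dots> \<le> (\<Sum>f\<in>F. card {x \<in> p. - f + x \<in> V})" by (rule card_UN_le[OF F(1)])
    also have "\<dots> \<le> (\<Sum>f\<in>F. card q)"
    proof (rule sum_mono)
      fix f
      have "card ((+) (- f) ` {x \<in> p. - f + x \<in> V}) \<le> card q"
        using \<open>finite p\<close> by (intro max_q separated_translate separated_subset[OF sep_p]) auto
      then show "card {x \<in> p. - f + x \<in> V} \<le> card q" by (simp add: card_translate)
    qed
    finally show ?thesis by simp
  qed
  moreover have "card Z = card (Z \<inter> K) + card (Z - K)"
    using card_Int_Diff[OF fin(3)] .
  \<comment> \<open>\<open>Z \<inter> K\<close> contributes at most \<open>card p\<close>, and
    \<open>Z - K\<close> at most \<open>card p - card q\<close>.\<close>
  ultimately have "card Z + card q \<le> 2 * card p" and le: "card p \<le> card F * card q" by simp_all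
  then have "card F * (card Z + card q) \<le> card F * (2 * card p)" by (intro mult_le_mono) auto
  then show ?thesis using le unfolding card_Z by (simp add: algebra_simps)
qed

section \<open>Compactness and limits along filters\<close>

text \<open>Mazur's theorem: \<open>S\<close> lies in the convex set \<open>D\<close>, a thickening
  of the compact hull of a finite net. The three thirds of \<open>e\<close> pay for the closure, the
  thickening and the net of that hull. Averages of a continuous function over subsets of a compact
  set thus stay in a compact set.\<close>

lemma compact_closure_convex_hull:
  fixes S :: "'e::banach set"
  assumes "compact S"
  shows "compact (closure (convex hull S))"
proof -
  have "\<exists>k. finite k \<and> closure (convex hull S) \<subseteq> (\<Union>x\<in>k. ball x e)" if "e > 0" for e
  proof -
    have e: "e / 3 > 0" using that by simp
    obtain k where k: "finite k" "S \<subseteq> (\<Union>x\<in>k. ball x (e / 3))"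
      using assms e unfolding compact_eq_totally_bounded by blast
    obtain k' where k': "finite k'" "convex hull k \<subseteq> (\<Union>x\<in>k'. ball x (e / 3))"
      using finite_imp_compact_convex_hull[OF k(1)] e unfolding compact_eq_totally_bounded by blast
    define D where "D = (\<Union>a\<in>convex hull k. \<Union>b\<in>ball 0 (e / 3). {a + b})"
    have "convex D"
      unfolding D_def by (intro convex_sums convex_convex_hull convex_ball)
    moreover have "S \<subseteq> D"
    proof
      fix x assume "x \<in> S"
      then obtain a where "a \<in> k" "dist a x < e / 3" using k(2) by auto
      then show "x \<in> D"
        unfolding D_def using hull_inc[of a k convex]
        by (intro UN_I[of a] UN_I[of "x - a"]) (auto simp: dist_norm norm_minus_commute)
    qed
    ultimately have hull: "convex hull S \<subseteq> D" by (rule hull_minimal[rotated])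
    have "closure (convex hull S) \<subseteq> (\<Union>x\<in>k'. ball x e)"
    proof
      fix y assume "y \<in> closure (convex hull S)"
      then obtain x where x: "x \<in> convex hull S" "dist x y < e / 3"
        using e unfolding closure_approachable by blast
      then obtain a b where ab: "a \<in> convex hull k" "norm b < e / 3" "x = a + b"
        using hull unfolding D_def by auto
      then obtain c where c: "c \<in> k'" "dist c a < e / 3" using k'(2) by auto
      have "dist a x < e / 3" using ab by (simp add: dist_norm)
      then have "dist c y < e" using dist_triangle_third[of c a e x y] c(2) x(2) by simp
      then show "y \<in> (\<Union>x\<in>k'. ball x e)" using c(1) by auto
    qed
    then show ?thesis
      using k'(1) by blast
  qed
  then show ?thesis
    unfolding compact_eq_totally_bounded using complete_eq_closed closed_closure by blast
qed

text \<open>By Tychonoff \<open>\<Phi>\<close> has a cluster point in the product, and refining the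
  filter there gives one filter that serves all indices. Linearity of the limit needs this, as it
  compares several functions along the same filter.\<close>

lemma simultaneous_limits:
  fixes \<Phi> :: "'u \<Rightarrow> 'i \<Rightarrow> 'a::topological_space"
  assumes "\<F> \<noteq> bot" "\<And>i. compact (C i)" "\<And>u i. \<Phi> u i \<in> C i"
  obtains \<G> I where "\<G> \<le> \<F>" "\<G> \<noteq> bot" "\<And>i. ((\<lambda>u. \<Phi> u i) \<longlongrightarrow> I i) \<G>"
proof -
  have "compactin (product_topology (\<lambda>i. euclidean) UNIV) (PiE UNIV C)"
    unfolding compactin_PiE using assms(2) by auto
  then have "compact (PiE UNIV C)"
    by (simp add: euclidean_product_topology)
  moreover have "eventually (\<lambda>x. x \<in> PiE UNIV C) (filtermap \<Phi> \<F>)"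
    unfolding eventually_filtermap by (rule always_eventually) (simp add: assms(3) PiE_iff)
  moreover have "filtermap \<Phi> \<F> \<noteq> bot"
    using assms(1) by (simp add: filtermap_bot_iff)
  ultimately obtain I where I: "inf (nhds I) (filtermap \<Phi> \<F>) \<noteq> bot"
    unfolding compact_filter by blast
  \<comment> \<open>The coarsest refinement of \<open>\<F>\<close> along which \<open>\<Phi>\<close>
    tends to \<open>I\<close>; it is proper because \<open>I\<close> is a cluster point.\<close>
  define \<G> where "\<G> = inf \<F> (filtercomap \<Phi> (nhds I))"
  have "\<G> \<noteq> bot"
  proof
    assume "\<G> = bot"
    then have "eventually (\<lambda>_. False) \<G>" by simp
    then obtain P Q where PQ: "eventually P \<F>" "eventually Q (filtercomap \<Phi> (nhds I))" "\<And>x. P x \<Longrightarrow> Q x \<Longrightarrow> False"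
      unfolding \<G>_def eventually_inf by blast
    obtain R where R: "eventually R (nhds I)" "\<And>x. R (\<Phi> x) \<Longrightarrow> Q x"
      using PQ(2) unfolding eventually_filtercomap by blast
    have "eventually (\<lambda>x. \<not> R x) (filtermap \<Phi> \<F>)"
      unfolding eventually_filtermap using PQ(1) by eventually_elim (use PQ(3) R(2) in blast)
    then have "eventually (\<lambda>_. False) (inf (nhds I) (filtermap \<Phi> \<F>))"
      using R(1) unfolding eventually_inf by blast
    then show False using I by (simp add: trivial_limit_def)
  qed
  moreover have "filterlim \<Phi> (nhds I) \<G>"
    by (rule filterlim_mono[OF filterlim_filtercomap order_refl]) (simp add: \<G>_def)
  then have "((\<lambda>u. \<Phi> u i) \<longlongrightarrow> I i) \<G>" for i
    using continuous_on_product_coordinates[of i]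
    by (intro continuous_on_tendsto_compose[of UNIV "\<lambda>x. x i" \<Phi>]) auto
  moreover have "\<G> \<le> \<F>" by (simp add: \<G>_def)
  ultimately show ?thesis using that by blast
qed

section \<open>Word balls of a compact generating set\<close>

primrec word_ball :: "'g::group_add set \<Rightarrow> nat \<Rightarrow> 'g set"
  where "word_ball S 0 = {0}"
  | "word_ball S (Suc n) = (\<lambda>(s, g). s + g) ` (insert 0 S \<times> word_ball S n)"

lemma compact_word_ball:
  fixes S :: "'g::topological_group_add set"
  assumes "compact S"
  shows "compact (word_ball S n)"
proof (induction n)
  case (Suc n)
  show ?case
    unfolding word_ball.simps case_prod_unfold
    by (intro compact_continuous_image continuous_intros compact_Times compact_insert assms Suc)
qed simp

lemma word_ball_add: "g \<in> word_ball S m \<Longrightarrow> h \<in> word_ball S n \<Longrightarrow> g + h \<in> word_ball S (m + n)"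
proof (induction m arbitrary: g)
  case (Suc m)
  then obtain s g' where sg: "g = s + g'" "s \<in> insert 0 S" "g' \<in> word_ball S m" by auto
  have "s + (g' + h) \<in> word_ball S (Suc (m + n))"
    using Suc.IH[OF sg(3) Suc.prems(2)] sg(2) by force
  then show ?case using sg by (simp add: add.assoc)
qed simp

lemma zero_in_word_ball: "0 \<in> word_ball S n"
  by (induction n) force+

lemma word_ball_mono: "m \<le> n \<Longrightarrow> word_ball S m \<subseteq> word_ball S n"
  using word_ball_add[OF zero_in_word_ball[of S "n - m"], of _ m] by auto

lemma word_ball_1: "s \<in> S \<Longrightarrow> s \<in> word_ball S 1"
  by force

lemma word_ball_minus:
  assumes "uminus ` S = S"
  shows "g \<in> word_ball S n \<Longrightarrow> - g \<in> word_ball S n"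
proof (induction n arbitrary: g)
  case (Suc n)
  then obtain s g' where sg: "g = s + g'" "s \<in> insert 0 S" "g' \<in> word_ball S n" by auto
  have "- s \<in> insert 0 S" using sg(2) assms by auto
  then have "- s \<in> word_ball S 1" using zero_in_word_ball word_ball_1 by (metis insertE)
  then show ?case using word_ball_add[OF Suc.IH[OF sg(3)], of "- s" 1] sg(1) by (simp add: minus_add)
qed simp

lemma Union_word_ball:
  assumes "uminus ` S = S" "generates_group S"
  shows "(\<Union>n. word_ball S n) = UNIV"
proof (rule assms(2)[unfolded generates_group_def, THEN spec, THEN mp, THEN mp, THEN mp, THEN mp])
  show "S \<subseteq> (\<Union>n. word_ball S n)" using word_ball_1 by blast
  show "0 \<in> (\<Union>n. word_ball S n)" using zero_in_word_ball by blast
  show "\<forall>x\<in>\<Union>n. word_ball S n. \<forall>y\<in>\<Union>n. word_ball S n. x + y \<in> (\<Union>n. word_ball S n)"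
    using word_ball_add by blast
  show "\<forall>x\<in>\<Union>n. word_ball S n. - x \<in> (\<Union>n. word_ball S n)"
    using word_ball_minus[OF assms(1)] by blast
qed

text \<open>\<open>S\<close> may fail to be a neighbourhood of the identity, but by Baire category
  some word ball has interior. Its translates show that the interiors of word balls cover the group,
  and compactness finishes. This bounds cocycles on \<open>K\<close> by their values on
  \<open>S\<close>.\<close>

lemma compact_subset_word_ball:
  fixes S :: "'g::{topological_group_add, t2_space} set"
  assumes lc: "locally_compact_space (euclidean :: 'g topology)"
    and S: "compact S" "uminus ` S = S" "generates_group S" and "compact K"
  obtains n where "K \<subseteq> word_ball S n"
proof -
  let ?B = "word_ball S"
  have "regular_space (euclidean :: 'g topology)"
    by (rule locally_compact_Hausdorff_imp_regular_space[OF lc])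
       (metis Hausdorff_space_def disjnt_def hausdorff open_openin)
  moreover have "closed (?B n)" for n
    by (intro compact_imp_closed compact_word_ball S)
  ultimately obtain n where "interior (?B n) \<noteq> {}"
    using Baire_category_alt[of "euclidean :: 'g topology" "range ?B"] lc Union_word_ball[OF S(2,3)] by fastforce
  then obtain x where x: "x \<in> interior (?B n)" by blast
  have cover: "\<exists>m. g \<in> interior (?B m)" for g
  proof -
    obtain m where m: "g - x \<in> ?B m" using Union_word_ball[OF S(2,3)] by blast
    \<comment> \<open>The preimage is the translate of the interior by \<open>g - x\<close>, which
      moves \<open>x\<close> to \<open>g\<close>.\<close>
    have "(\<lambda>h. x + (- g + h)) -` interior (?B n) \<subseteq> ?B (m + n)"
    proof
      fix h assume "h \<in> (\<lambda>h. x + (- g + h)) -` interior (?B n)"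
      then have "x + (- g + h) \<in> ?B n" using interior_subset by blast
      moreover have "h = (g - x) + (x + (- g + h))"
        by (metis add.assoc diff_add_cancel add_minus_cancel)
      ultimately show "h \<in> ?B (m + n)" using word_ball_add[OF m] by metis
    qed
    moreover have "open ((\<lambda>h. x + (- g + h)) -` interior (?B n))"
      by (intro open_vimage continuous_intros) auto
    moreover have "g \<in> (\<lambda>h. x + (- g + h)) -` interior (?B n)" using x by simp
    ultimately show ?thesis using interior_maximal by blast
  qed
  have "K \<subseteq> (\<Union>m\<in>UNIV. interior (?B m))" using cover by blast
  then obtain M where M: "finite M" "K \<subseteq> (\<Union>m\<in>M. interior (?B m))"
    using compactE_image[OF \<open>compact K\<close>, of UNIV "\<lambda>m. interior (?B m)"] by auto
  have "interior (?B m) \<subseteq> ?B (Max M)" if "m \<in> M" for m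
    using word_ball_mono[of m "Max M" S] that M(1) interior_subset by fastforce
  then show ?thesis using M(2) by (intro that[of "Max M"]) blast
qed

section \<open>Isometric representations\<close>

text \<open>\<open>N\<close> is the number of translates of \<open>V\<close> covering
  \<open>K\<close>. Being chosen before \<open>U\<close>, it bounds the lost proportion uniformly as
  \<open>U\<close> shrinks.\<close>

lemma averaging_sets:
  fixes S :: "'g::{topological_group_add, t2_space} set"
  assumes lc: "locally_compact_space (euclidean :: 'g topology)"
    and S: "compact S" "uminus ` S = S"
  obtains K V :: "'g set" and N :: nat and p :: "'g set \<Rightarrow> 'g set"
  where "compact K" "open V" "0 \<in> V" "0 < N" "\<And>U. finite (p U)" "\<And>U. p U \<subseteq> K" "\<And>U. p U \<noteq> {}"
    "\<And>U. open U \<Longrightarrow> 0 \<in> U \<Longrightarrow> U \<subseteq> V \<Longrightarrow> separated U (p U)"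
    "\<And>U s P. open U \<Longrightarrow> 0 \<in> U \<Longrightarrow> U \<subseteq> V \<Longrightarrow> s \<in> S \<Longrightarrow> P \<subseteq> p U \<Longrightarrow> separated U (P \<union> (+) s ` P)
      \<Longrightarrow> P \<inter> (+) s ` P = {} \<Longrightarrow> 2 * N * card P + card (p U) \<le> 2 * N * card (p U)"
proof -
  obtain O0 W :: "'g set" where W: "open O0" "compact W" "0 \<in> O0" "O0 \<subseteq> W"
    using lc unfolding locally_compact_space_def by simp metis
  \<comment> \<open>Adjoining \<open>S + W\<close> makes room for \<open>- s + w\<close> with
    \<open>w\<close> in \<open>W\<close>, because \<open>S\<close> is symmetric.\<close>
  define K where "K = W \<union> (\<lambda>(s, w). s + w) ` (S \<times> W)"
  have K: "compact K"
    unfolding K_def case_prod_unfold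
    by (intro compact_Un compact_continuous_image continuous_intros compact_Times S W)
  have WK: "- s + w \<in> K" if "s \<in> S" "w \<in> W" for s w
    using that S(2) unfolding K_def by force
  obtain V where V: "open V" "0 \<in> V" "\<And>x y. x \<in> V \<Longrightarrow> y \<in> V \<Longrightarrow> x + y \<in> O0 \<and> x - y \<in> O0"
    using nhd_zero_operations[OF W(1,3)] by metis
  have "V \<subseteq> W" using V(3)[OF _ V(2)] W(4) by auto
  then have "V \<subseteq> K" by (auto simp: K_def)
  obtain F where F: "finite F" "\<And>x. x \<in> K \<Longrightarrow> \<exists>f\<in>F. - f + x \<in> V"
    using compact_cover_translates[OF K V(1,2)] by blast
  \<comment> \<open>Off the neighbourhoods of \<open>0\<close> the default \<open>{0}\<close> keeps
    \<open>p U\<close> a finite nonempty subset of \<open>K\<close>, so means are defined for every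
    index \<open>U\<close>.\<close>
  define p where "p U = (if open U \<and> 0 \<in> U then SOME p. max_separated U K p else {0})" for U
  have p: "max_separated U K (p U)" if "open U" "0 \<in> U" for U
    using someI_ex[OF max_separated_exists[OF K order_refl that]] that by (simp add: p_def)
  have "0 \<in> K" using V(2) \<open>V \<subseteq> K\<close> by blast
  then have "0 < card F" using F card_gt_0_iff by blast
  have p': "finite (p U) \<and> p U \<subseteq> K \<and> p U \<noteq> {}" for U
  proof (cases "open U \<and> 0 \<in> U")
    case True
    then have "max_separated U K (p U)" using p by blast
    then have m: "p U \<subseteq> K" "finite (p U)"
      "\<And>q. q \<subseteq> K \<Longrightarrow> finite q \<Longrightarrow> separated U q \<Longrightarrow> card q \<le> card (p U)"
      unfolding max_separated_def by blast+
    have "card {0 :: 'g} \<le> card (p U)"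
      using \<open>0 \<in> K\<close> by (intro m(3)) (auto simp: separated_def)
    then show ?thesis using m by auto
  qed (use \<open>0 \<in> K\<close> in \<open>auto simp: p_def\<close>)
  show ?thesis
  proof (rule that[of K V "card F" p])
    fix U :: "'g set" assume U: "open U" "0 \<in> U" "U \<subseteq> V"
    show "separated U (p U)" using p[OF U(1,2)] by (simp add: max_separated_def)
    fix s P assume P: "s \<in> S" "P \<subseteq> p U" "separated U (P \<union> (+) s ` P)" "P \<inter> (+) s ` P = {}"
    obtain q where q: "max_separated U V q"
      using max_separated_exists[OF K \<open>V \<subseteq> K\<close> U(1,2)] by blast
    \<comment> \<open>Choosing both subsets of \<open>p U\<close> equal to \<open>P\<close> produces
      the factor \<open>2 * N\<close>.\<close>
    have "card F * (card P + card P) + card (p U) \<le> 2 * card F * card (p U)"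
      using U(3) V(3) W(4) WK[OF P(1)]
      by (intro separated_union_translate_card[OF p[OF U(1,2)] q F \<open>V \<subseteq> W\<close> _ _ _ P(2,2,3,4)])
         (auto simp: K_def)
    then show "2 * card F * card P + card (p U) \<le> 2 * card F * card (p U)"
      by (simp add: algebra_simps)
  qed (use K V p' \<open>0 < card F\<close> in auto)
qed

text \<open>If most points \<open>\<pi> g v\<close>, \<open>g \<in> p\<close>, were close to \<open>w\<close>, then most points \<open>\<pi> (s + g) v\<close> would be close to
  \<open>\<pi> s w\<close>, hence far from the former; the two sets of group elements would be separated.\<close>

lemma isometric_orbit_spread:
  assumes \<pi>: "strongly_continuous_rep \<pi>" "isometric_rep \<pi>" and "finite p" and sep: "separated U p"
    and H: "\<And>P. P \<subseteq> p \<Longrightarrow> separated U (P \<union> (+) s ` P) \<Longrightarrow> P \<inter> (+) s ` P = {} \<Longrightarrow>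
      2 * N * card P + card p \<le> 2 * N * card p"
    and "0 \<in> U" and U: "\<And>u. u \<in> U \<Longrightarrow> norm (\<pi> u v - v) < \<epsilon>"
    and w: "4 * \<epsilon> \<le> norm (\<pi> s w - w)"
  shows "card p \<le> 2 * N * card {g \<in> p. \<epsilon> \<le> norm (w - \<pi> g v)}"
proof -
  interpret bounded_linear "\<pi> g" for g
    using \<pi> by (simp add: strongly_continuous_rep_def)
  have \<pi>_add: "\<pi> (g + h) x = \<pi> g (\<pi> h x)" and norm_\<pi>: "norm (\<pi> g x) = norm x" for g h x
    using \<pi> by (simp_all add: strongly_continuous_rep_def isometric_rep_def)
  define P where "P = {g \<in> p. norm (w - \<pi> g v) < \<epsilon>}"
  have "P \<subseteq> p" by (auto simp: P_def)
  \<comment> \<open>Isometry carries the small displacement of \<open>v\<close> by elements of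
    \<open>U\<close> to every point of its orbit.\<close>
  have near: "norm (\<pi> x v - \<pi> y v) < \<epsilon>" if "- x + y \<in> U" for x y
  proof -
    have "\<pi> y v = \<pi> x (\<pi> (- x + y) v)" by (simp flip: \<pi>_add add.assoc)
    then have "\<pi> x v - \<pi> y v = \<pi> x (v - \<pi> (- x + y) v)" by (simp add: diff)
    then show ?thesis using U[OF that] by (simp add: norm_\<pi> norm_minus_commute)
  qed
  \<comment> \<open>Out of the displacement \<open>4 * \<epsilon>\<close> of \<open>w\<close>, the
    two approximations use less than \<open>2 * \<epsilon>\<close>; what remains exceeds
    \<open>\<epsilon>\<close>.\<close>
  have far: "\<epsilon> \<le> norm (\<pi> x v - \<pi> (s + g) v)" if x: "x \<in> P" and g: "g \<in> P" for x g
  proof -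
    have eq: "\<pi> s w - w = \<pi> s (w - \<pi> g v) - (w - \<pi> x v) - (\<pi> x v - \<pi> (s + g) v)"
      by (simp add: diff \<pi>_add)
    have "norm (\<pi> s w - w) \<le> norm (w - \<pi> g v) + norm (w - \<pi> x v) + norm (\<pi> x v - \<pi> (s + g) v)"
      unfolding eq
      using norm_triangle_ineq4[of "\<pi> s (w - \<pi> g v) - (w - \<pi> x v)" "\<pi> x v - \<pi> (s + g) v"]
        norm_triangle_ineq4[of "\<pi> s (w - \<pi> g v)" "w - \<pi> x v"] norm_\<pi>[of s "w - \<pi> g v"] by linarith
    moreover have "norm (w - \<pi> g v) < \<epsilon>" "norm (w - \<pi> x v) < \<epsilon>"
      using x g by (auto simp: P_def)
    ultimately show ?thesis using w norm_ge_zero[of "w - \<pi> g v"] by linarith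
  qed
  have cross: "- x + (s + g) \<notin> U" "- (s + g) + x \<notin> U" if "x \<in> P" "g \<in> P" for x g
    using far[OF that] near[of x "s + g"] near[of "s + g" x] norm_minus_commute[of "\<pi> x v" "\<pi> (s + g) v"] by auto
  have sepP: "separated U P" using separated_subset[OF sep \<open>P \<subseteq> p\<close>] .
  have "separated U (P \<union> (+) s ` P)"
    using sepP separated_translate[OF sepP, of s] cross unfolding separated_def by (metis UnE imageE)
  moreover have "s + g \<notin> P" if "g \<in> P" for g
    using cross(1)[OF _ that, of "s + g"] \<open>0 \<in> U\<close> by auto
  then have "P \<inter> (+) s ` P = {}" by blast
  ultimately have "2 * N * card P + card p \<le> 2 * N * card p"
    by (rule H[OF \<open>P \<subseteq> p\<close>])
  moreover have "card p = card P + card {g \<in> p. \<epsilon> \<le> norm (w - \<pi> g v)}"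
  proof -
    have "p = P \<union> {g \<in> p. \<epsilon> \<le> norm (w - \<pi> g v)}" "P \<inter> {g \<in> p. \<epsilon> \<le> norm (w - \<pi> g v)} = {}"
      by (auto simp: P_def)
    then show ?thesis using \<open>finite p\<close> card_Un_disjoint[of P "{g \<in> p. \<epsilon> \<le> norm (w - \<pi> g v)}"] \<open>P \<subseteq> p\<close>
      by (metis (no_types, lifting) finite_Un)
  qed
  ultimately show ?thesis by (simp add: algebra_simps)
qed

section \<open>Finite means and the contraction estimate\<close>

definition mean :: "'g set \<Rightarrow> ('g \<Rightarrow> 'e::real_vector) \<Rightarrow> 'e"
  where "mean p f = (1 / real (card p)) *\<^sub>R sum f p"

lemma mean_add: "mean p (\<lambda>g. f g + h g) = mean p f + mean p h"
  by (simp add: mean_def sum.distrib scaleR_add_right)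

lemma mean_scaleR: "mean p (\<lambda>g. r *\<^sub>R f g) = r *\<^sub>R mean p f"
  by (simp add: mean_def scaleR_sum_right)

lemma mean_const: "finite p \<Longrightarrow> p \<noteq> {} \<Longrightarrow> mean p (\<lambda>_. v) = v"
  by (simp add: mean_def sum_constant_scaleR)

lemma mean_in_convex_hull:
  assumes "finite p" "p \<noteq> {}" "p \<subseteq> K"
  shows "mean p f \<in> convex hull (f ` K)"
proof -
  have "(\<Sum>g\<in>p. (1 / real (card p)) *\<^sub>R f g) \<in> convex hull (f ` K)"
    using assms by (intro convex_sum) (auto intro: hull_inc)
  then show ?thesis by (simp add: mean_def scaleR_sum_right)
qed

lemma norm_mean_le:
  assumes "finite p" "p \<noteq> {}" "\<And>g. g \<in> p \<Longrightarrow> norm (f g) \<le> c"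
  shows "norm (mean p f) \<le> c"
proof -
  have "norm (sum f p) \<le> real (card p) * c"
    using assms(3) by (intro order_trans[OF norm_sum sum_bounded_above]) auto
  then show ?thesis
    using assms(1,2) by (simp add: mean_def pos_divide_le_eq card_gt_0_iff mult.commute)
qed

text \<open>Each midpoint of \<open>w\<close> and \<open>f g\<close> has norm at most
  \<open>1\<close>, and those with \<open>f g\<close> far from \<open>w\<close> lose
  \<open>\<delta>\<close>. At least the proportion \<open>1 / (2 * N)\<close> is far, whence the
  averaged loss.\<close>

lemma norm_mean_uniformly_convex:
  fixes f :: "'g \<Rightarrow> 'e::real_normed_vector"
  assumes p: "finite p" "p \<noteq> {}" and spread: "card p \<le> 2 * N * card {g \<in> p. \<epsilon> \<le> norm (w - f g)}"
    and w: "norm w = 1" and f: "\<And>g. g \<in> p \<Longrightarrow> norm (f g) = 1"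
    and uc: "\<And>x y :: 'e. norm x = 1 \<Longrightarrow> norm y = 1 \<Longrightarrow> \<epsilon> \<le> norm (x - y) \<Longrightarrow> norm ((1 / 2) *\<^sub>R (x + y)) \<le> 1 - \<delta>"
    and "\<delta> > 0"
  shows "norm ((1 / 2) *\<^sub>R (w + mean p f)) \<le> 1 - \<delta> / (2 * real N)"
proof -
  define G where "G = {g \<in> p. \<epsilon> \<le> norm (w - f g)}"
  have c: "0 < card p" using p by (simp add: card_gt_0_iff)
  then have N: "0 < N" using spread by (cases N) auto
  \<comment> \<open>The midpoint of \<open>w\<close> and the mean is the mean of the
    midpoints.\<close>
  have half: "(1 / 2) *\<^sub>R (w + mean p f) = mean p (\<lambda>g. (1 / 2) *\<^sub>R (w + f g))"
    using mean_const[OF p, of w] by (simp add: mean_scaleR mean_add del: scaleR_add_right)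
  have "norm (sum (\<lambda>g. (1 / 2) *\<^sub>R (w + f g)) p) \<le> (\<Sum>g\<in>p. 1 - (if g \<in> G then \<delta> else 0))"
  proof (rule order_trans[OF norm_sum sum_mono])
    fix g assume g: "g \<in> p"
    have "norm ((1 / 2) *\<^sub>R (w + f g)) \<le> 1"
      using norm_triangle_ineq[of w "f g"] w f[OF g] by simp
    then show "norm ((1 / 2) *\<^sub>R (w + f g)) \<le> 1 - (if g \<in> G then \<delta> else 0)"
      using uc[OF w f[OF g]] g by (auto simp: G_def)
  qed
  also have "\<dots> = card p - \<delta> * card G"
  proof -
    have "p \<inter> G = G" by (auto simp: G_def)
    then show ?thesis using p(1) by (simp add: sum_subtractf sum.If_cases)
  qed
  also have "\<dots> \<le> card p - \<delta> * (card p / (2 * N))"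
  proof -
    have "real (card p) \<le> real (2 * N * card G)" using spread unfolding G_def of_nat_le_iff .
    then have "card p / (2 * real N) \<le> card G" using N by (simp add: field_simps)
    then show ?thesis using \<open>\<delta> > 0\<close> by (intro diff_left_mono mult_left_mono) auto
  qed
  also have "\<dots> = card p * (1 - \<delta> / (2 * real N))" by (simp add: algebra_simps)
  finally show ?thesis
    unfolding half unfolding mean_def using c by (simp add: pos_divide_le_eq mult.commute)
qed

text \<open>For an isometric representation the cocycle identity makes the norm of a cocycle
  subadditive, so it grows at most linearly with word length.\<close>

lemma isometric_cocycle_word_ball:
  fixes \<pi> :: "'g::topological_group_add \<Rightarrow> 'e::real_normed_vector \<Rightarrow> 'e"
  assumes \<pi>: "strongly_continuous_rep \<pi>" "isometric_rep \<pi>" and z: "z \<in> cocycles \<pi>" and "compact S"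
  shows "g \<in> word_ball S n \<Longrightarrow> norm (z g) \<le> real n * sup_norm_on S z"
proof (induction n arbitrary: g)
  case 0
  then show ?case using cocycle_0[OF \<pi>(1) z] by simp
next
  case (Suc n)
  have cont: "continuous_on UNIV z" using z by (simp add: cocycles_def)
  obtain s h where sh: "g = s + h" "s \<in> insert 0 S" "h \<in> word_ball S n" using Suc.prems by auto
  have "norm (z s) \<le> sup_norm_on S z"
    using sh(2) cocycle_0[OF \<pi>(1) z] norm_le_sup_norm_on[OF \<open>compact S\<close> cont] sup_norm_on_nonneg[OF \<open>compact S\<close> cont]
    by auto
  moreover have "norm (z g) \<le> norm (z h) + norm (z s)"
    using norm_triangle_ineq[of "\<pi> s (z h)" "z s"] \<pi>(2) by (simp add: sh(1) cocycle_add[OF z] isometric_rep_def)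
  ultimately show ?case using Suc.IH[OF sh(3)] by (simp add: algebra_simps)
qed

lemma cocycles_decompose_if_isometric:
  fixes S :: "'g::{topological_group_add, t2_space} set"
    and \<pi> :: "'g \<Rightarrow> 'e::banach \<Rightarrow> 'e"
  assumes lc: "locally_compact_space (euclidean :: 'g topology)"
    and S: "compact S" "uminus ` S = S" "generates_group S"
    and \<pi>: "strongly_continuous_rep \<pi>" "isometric_rep \<pi>"
    and uc: "uniformly_convex TYPE('e)" and "no_almost_invariant_vectors S \<pi>"
  shows "cocycles_decompose S \<pi>"
proof -
  have \<pi>_cont: "continuous_on UNIV (\<lambda>g. \<pi> g v)" and \<pi>_lin: "bounded_linear (\<pi> g)" and \<pi>_0: "\<pi> 0 v = v"
    and norm_\<pi>: "norm (\<pi> g v) = norm v" for g v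
    using \<pi> by (simp_all add: strongly_continuous_rep_def isometric_rep_def)
  obtain \<kappa> where "\<kappa> > 0" and \<kappa>: "\<And>v. \<kappa> * norm v \<le> sup_norm_on S (\<lambda>s. \<pi> s v - v)"
    using assms(8) unfolding no_almost_invariant_vectors_def by blast
  \<comment> \<open>Then \<open>4 * \<epsilon>\<close> is half of \<open>\<kappa>\<close>, strictly
    below the supremum of the displacements of a unit vector, so some \<open>s\<close> in
    \<open>S\<close> moves it that far.\<close>
  define \<epsilon> where "\<epsilon> = \<kappa> / 8"
  have "\<epsilon> > 0" using \<open>\<kappa> > 0\<close> by (simp add: \<epsilon>_def)
  obtain \<delta> where "\<delta> > 0" and \<delta>: "\<And>x y :: 'e. norm x = 1 \<Longrightarrow> norm y = 1 \<Longrightarrow> \<epsilon> \<le> norm (x - y) \<Longrightarrow>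
      norm ((1 / 2) *\<^sub>R (x + y)) \<le> 1 - \<delta>"
    using uc \<open>\<epsilon> > 0\<close> unfolding uniformly_convex_def by metis
  obtain K V :: "'g set" and N :: nat and p :: "'g set \<Rightarrow> 'g set" where
    K: "compact K" and V: "open V" "0 \<in> V" and N: "0 < N" and p: "\<And>U. finite (p U)" "\<And>U. p U \<subseteq> K" "\<And>U. p U \<noteq> {}"
    and sep: "\<And>U. open U \<Longrightarrow> 0 \<in> U \<Longrightarrow> U \<subseteq> V \<Longrightarrow> separated U (p U)"
    and overlap: "\<And>U s P. open U \<Longrightarrow> 0 \<in> U \<Longrightarrow> U \<subseteq> V \<Longrightarrow> s \<in> S \<Longrightarrow> P \<subseteq> p U \<Longrightarrow> separated U (P \<union> (+) s ` P)
      \<Longrightarrow> P \<inter> (+) s ` P = {} \<Longrightarrow> 2 * N * card P + card (p U) \<le> 2 * N * card (p U)"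
    using averaging_sets[OF lc S(1,2)] by (metis (no_types, lifting))
  obtain n where n: "K \<subseteq> word_ball S n"
    using compact_subset_word_ball[OF lc S K] by blast

  \<comment> \<open>The filter of identity neighbourhoods \<open>U\<close> shrinking to
    \<open>0\<close>; the group may have no countable neighbourhood base, so a sequence would not
    do.\<close>
  define \<F> where "\<F> = (INF W\<in>{W :: 'g set. open W \<and> 0 \<in> W}. principal {U. open U \<and> 0 \<in> U \<and> U \<subseteq> W})"
  have small: "eventually (\<lambda>U. open U \<and> 0 \<in> U \<and> U \<subseteq> W) \<F>" if "open W" "0 \<in> W" for W
    unfolding \<F>_def using that by (intro eventually_INF1[of W]) (auto simp: eventually_principal)
  have "\<F> \<noteq> bot"
  proof
    assume "\<F> = bot"
    then have "eventually (\<lambda>_. False) \<F>" by simp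
    moreover have "\<exists>W\<in>{W. open W \<and> 0 \<in> W}. principal {U. open U \<and> 0 \<in> U \<and> U \<subseteq> W}
        \<le> inf (principal {U. open U \<and> 0 \<in> U \<and> U \<subseteq> A}) (principal {U. open U \<and> 0 \<in> U \<and> U \<subseteq> B})"
      if "A \<in> {W. open W \<and> 0 \<in> W}" "B \<in> {W. open W \<and> 0 \<in> W}" for A B :: "'g set"
      using that by (intro bexI[of _ "A \<inter> B"]) auto
    ultimately obtain W :: "'g set" where "open W" "0 \<in> W" "\<And>U. \<not> (open U \<and> 0 \<in> U \<and> U \<subseteq> W)"
      unfolding \<F>_def by (subst (asm) eventually_INF_base) (auto simp: eventually_principal)
    then show False by blast
  qed
  \<comment> \<open>The index type consists of all functions, so discontinuous ones get the constant
    value \<open>0\<close> and the compact set \<open>{0}\<close>.\<close>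
  define \<Phi> where "\<Phi> U F = (if continuous_on UNIV F then mean (p U) F else 0)" for U and F :: "'g \<Rightarrow> 'e"
  define C where "C F = (if continuous_on UNIV F then closure (convex hull (F ` K)) else {0})" for F :: "'g \<Rightarrow> 'e"
  have "compact (C F)" for F
    unfolding C_def using compact_closure_convex_hull[OF compact_continuous_image[OF _ K]]
    by (auto intro: continuous_on_subset)
  moreover have "\<Phi> U F \<in> C F" for U F
    unfolding \<Phi>_def C_def using mean_in_convex_hull[OF p(1,3,2)] closure_subset by auto
  ultimately obtain \<G> I where "\<G> \<le> \<F>" "\<G> \<noteq> bot" and "\<And>F. ((\<lambda>U. \<Phi> U F) \<longlongrightarrow> I F) \<G>"
    using simultaneous_limits[OF \<open>\<F> \<noteq> bot\<close>, of C \<Phi>] by blast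
  then have lim: "((\<lambda>U. mean (p U) F) \<longlongrightarrow> I F) \<G>" if "continuous_on UNIV F" for F
    using that by (metis (mono_tags, lifting) \<Phi>_def tendsto_cong eventuallyI)
  note unique = tendsto_unique[OF \<open>\<G> \<noteq> bot\<close> lim]
  have I_add: "I (\<lambda>g. F g + H g) = I F + I H" if "continuous_on UNIV F" "continuous_on UNIV H" for F H
    using that tendsto_add[OF lim lim] by (intro unique) (auto intro: continuous_intros simp: mean_add)
  have I_scale: "I (\<lambda>g. r *\<^sub>R F g) = r *\<^sub>R I F" if "continuous_on UNIV F" for r F
    using that tendsto_scaleR[OF tendsto_const lim] by (intro unique) (auto intro: continuous_intros simp: mean_scaleR)
  have I_const: "I (\<lambda>_. v) = v" for v
    by (intro unique) (auto simp: mean_const[OF p(1,3)])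
  have I_le: "norm (I F) \<le> c" if "continuous_on UNIV F" "\<And>g. g \<in> K \<Longrightarrow> norm (F g) \<le> c" for F c
    using that(2) p
    by (intro tendsto_upperbound[OF tendsto_norm[OF lim[OF that(1)]] _ \<open>\<G> \<noteq> bot\<close>] always_eventually allI norm_mean_le) auto
  define A where "A v = I (\<lambda>g. \<pi> g v)" for v
  have A_scale: "A (r *\<^sub>R v) = r *\<^sub>R A v" for r v
    unfolding A_def linear_simps(5)[OF \<pi>_lin] by (rule I_scale[OF \<pi>_cont])
  \<comment> \<open>The midpoint with a unit vector loses \<open>\<delta> / (2 * N)\<close>, so
    \<open>A v\<close> itself loses twice as much; the cut-off covers
    \<open>A v = 0\<close>.\<close>
  define lam where "lam = max 0 (1 - \<delta> / real N)"
  have A_unit: "norm (A v) \<le> lam" if v: "norm v = 1" for v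
  proof (cases "A v = 0")
    case False
    define w where "w = (1 / norm (A v)) *\<^sub>R A v"
    have w: "norm w = 1" using False by (simp add: w_def)
    have "\<exists>s\<in>S. 4 * \<epsilon> \<le> norm (\<pi> s w - w)"
    proof (rule ccontr)
      assume "\<not> (\<exists>s\<in>S. 4 * \<epsilon> \<le> norm (\<pi> s w - w))"
      then have "sup_norm_on S (\<lambda>s. \<pi> s w - w) \<le> 4 * \<epsilon>"
        using \<open>\<epsilon> > 0\<close> by (intro sup_norm_on_le) auto
      then show False using \<kappa>[of w] w \<open>\<kappa> > 0\<close> by (simp add: \<epsilon>_def)
    qed
    then obtain s where s: "s \<in> S" "4 * \<epsilon> \<le> norm (\<pi> s w - w)" by blast
    \<comment> \<open>Only \<open>W\<close> depends on \<open>v\<close>; the bound that holds for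
      all \<open>U\<close> inside \<open>W\<close> does not.\<close>
    define W where "W = V \<inter> {u. norm (\<pi> u v - v) < \<epsilon>}"
    have W: "open W" "0 \<in> W"
      unfolding W_def using V \<open>\<epsilon> > 0\<close> \<pi>_0
      by (auto intro!: open_Int open_Collect_less continuous_intros \<pi>_cont)
    have bound: "norm ((1 / 2) *\<^sub>R (w + mean (p U) (\<lambda>g. \<pi> g v))) \<le> 1 - \<delta> / (2 * real N)"
      if U: "open U" "0 \<in> U" "U \<subseteq> W" for U
    proof (rule norm_mean_uniformly_convex[OF p(1,3) _ w _ \<delta> \<open>\<delta> > 0\<close>])
      have "U \<subseteq> V" using U(3) by (auto simp: W_def)
      show "card (p U) \<le> 2 * N * card {g \<in> p U. \<epsilon> \<le> norm (w - \<pi> g v)}"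
        using U by (intro isometric_orbit_spread[OF \<pi> p(1) sep[OF U(1,2) \<open>U \<subseteq> V\<close>]
              overlap[OF U(1,2) \<open>U \<subseteq> V\<close> s(1)] U(2) _ s(2)]) (auto simp: W_def)
    qed (simp_all add: norm_\<pi> v)
    have "eventually (\<lambda>U. norm ((1 / 2) *\<^sub>R (w + mean (p U) (\<lambda>g. \<pi> g v))) \<le> 1 - \<delta> / (2 * real N)) \<G>"
      using filter_leD[OF \<open>\<G> \<le> \<F>\<close> small[OF W]] by eventually_elim (use bound in blast)
    moreover have "((\<lambda>U. norm ((1 / 2) *\<^sub>R (w + mean (p U) (\<lambda>g. \<pi> g v)))) \<longlongrightarrow> norm ((1 / 2) *\<^sub>R (w + A v))) \<G>"
      unfolding A_def by (intro tendsto_intros lim \<pi>_cont)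
    ultimately have "norm ((1 / 2) *\<^sub>R (w + A v)) \<le> 1 - \<delta> / (2 * real N)"
      using tendsto_upperbound \<open>\<G> \<noteq> bot\<close> by blast
    \<comment> \<open>As \<open>w\<close> is parallel to \<open>A v\<close>, a bound on the midpoint
      is a bound on \<open>norm (A v)\<close>.\<close>
    moreover have "(1 / 2) *\<^sub>R (w + A v) = ((1 + norm (A v)) / 2) *\<^sub>R w"
      using False by (simp add: w_def scaleR_add_right algebra_simps flip: scaleR_add_left) (simp add: field_simps)
    ultimately have "(1 + norm (A v)) / 2 \<le> 1 - \<delta> / (2 * real N)"
      using w by simp
    then have "norm (A v) \<le> 1 - \<delta> / real N" by (simp add: field_simps)
    then show ?thesis by (simp add: lam_def)
  qed (simp add: lam_def)
  have contraction: "norm (A v) \<le> lam * norm v" for v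
  proof (cases "v = 0")
    case False
    then have "A v = norm v *\<^sub>R A ((1 / norm v) *\<^sub>R v)" by (simp flip: A_scale)
    then show ?thesis using A_unit[of "(1 / norm v) *\<^sub>R v"] False by (simp add: mult.commute mult_left_mono)
  qed (use A_scale[of 0 0] in simp)
  have "lam < 1" using N \<open>\<delta> > 0\<close> by (simp add: lam_def)
  have cont: "continuous_on UNIV z" if "z \<in> cocycles \<pi>" for z
    using that by (simp add: cocycles_def)
  show ?thesis
  proof (rule cocycles_decomposeI[OF \<pi>(1) S(1,3), where L = I and C = "real n" and M = 1 and lam = lam])
    show "I (z + w) = I z + I w" if "z \<in> cocycles \<pi>" "w \<in> cocycles \<pi>" for z w
      using I_add[OF cont cont, OF that] by (simp add: plus_fun_def)
    show "I (r *\<^sub>R z) = r *\<^sub>R I z" if "z \<in> cocycles \<pi>" for r z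
      using I_scale[OF cont, OF that] by (simp add: scaleR_fun_def)
    show "norm (I z) \<le> real n * sup_norm_on S z" if "z \<in> cocycles \<pi>" for z
      using isometric_cocycle_word_ball[OF \<pi> that S(1)] n by (intro I_le[OF cont[OF that]]) blast
    show "norm (v - I (codifferential \<pi> v)) \<le> lam * norm v" for v
    proof -
      have "I (\<lambda>g. v + (-1) *\<^sub>R \<pi> g v) = I (\<lambda>_. v) + (-1) *\<^sub>R A v"
        unfolding A_def I_scale[OF \<pi>_cont, symmetric] by (intro I_add continuous_intros \<pi>_cont)
      then have "I (codifferential \<pi> v) = v - A v"
        by (simp add: codifferential_def I_const)
      then show ?thesis using contraction by simp
    qed
  qed (use norm_\<pi> \<open>lam < 1\<close> in auto)
qed

theorem theorem1:
  fixes S :: "'g::{topological_group_add, t2_space} set"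
    and \<pi> :: "'g \<Rightarrow> 'e::banach \<Rightarrow> 'e"
  assumes "locally_compact_space (euclidean :: 'g topology)"
    and "compact S" and "uminus ` S = S" and "generates_group S"
    and "strongly_continuous_rep \<pi>"
  shows "((\<exists>\<mu> lam. prob_space \<mu> \<and> symmetric_measure \<mu> \<and> has_continuous_compact_density \<mu>
            \<and> generates_group (measure_supp \<mu>) \<and> measure_supp \<mu> \<subseteq> S
            \<and> onorm (markov_operator \<mu> \<pi>) \<le> lam \<and> lam < 1)
          \<longrightarrow> cocycles_decompose S \<pi>)
       \<and> (uniformly_convex TYPE('e) \<and> isometric_rep \<pi> \<and> no_almost_invariant_vectors S \<pi>
          \<longrightarrow> cocycles_decompose S \<pi>)"
proof (intro conjI impI; elim exE conjE)
  fix \<mu> lam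
  assume "prob_space \<mu>" "has_continuous_compact_density \<mu>" "measure_supp \<mu> \<subseteq> S"
    "onorm (markov_operator \<mu> \<pi>) \<le> lam" "lam < 1"
  then show "cocycles_decompose S \<pi>"
    by (rule cocycles_decompose_if_markov_contraction[OF assms(2,4,5)])
next
  assume "uniformly_convex TYPE('e)" "isometric_rep \<pi>" "no_almost_invariant_vectors S \<pi>"
  then show "cocycles_decompose S \<pi>"
    using cocycles_decompose_if_isometric assms by blast
qed

end
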